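(* Let $\pi:(X,S)\to(Y,S)$ be an extension of minimal topological dynamical systems with acting group $\mathbb Z$ (compact metric phase spaces), and let $d\ge1$ be an integer. Then $(\pi\times\pi)(\mathbf{RP}^{[d]}(X))=\mathbf{RP}^{[d]}(Y)$.
   Context: Here $T=\mathbb Z$, generated by the homeomorphism $S$. A system is minimal if all orbits are dense. An extension is a continuous equivariant surjection. $X^{[d]}=X^{2^d}$ has coordinates indexed by $\{0,1\}^d$ (equivalently subsets of $\{1,\dots,d\}$, $\emptyset\leftrightarrow(0,\dots,0)$); $x^{[d]}$ has all coordinates $x$. An upper facet of $\{0,1\}^d$ is a set $\{\epsilon:\epsilon_i=1\}$. For $t\in T$, $t^{(\alpha)}\in T^{[d]}$ has coordinate $t$ at $\epsilon\in\alpha$ and the identity elsewhere; $\mathcal F^{[d]}(T)$ is the subgroup of $T^{[d]}$ generated by all $t^{(\alpha)}$ with $\alpha$ an upper facet, acting coordinatewise on $X^{[d]}$. $(x,y)\in\mathbf{RP}^{[d]}(X)$ (regionally proximal of order $d$) if there are nets $(\mathbf f_\lambda)$ in $\mathcal F^{[d]}(T)$, $(x_\lambda),(y_\lambda)$ in $X$, and $\mathbf a_*\in X^{2^d-1}$ such that $(\mathbf f_\lambda x_\lambda^{[d]},\mathbf f_\lambda y_\lambda^{[d]})\to(x,\mathbf a_*,y,\mathbf a_* )$ (the first coordinate of each block is the $\emptyset$-coordinate). *)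

theory Defs
  imports "HOL-Analysis.Analysis" "HOL-Algebra.Elementary_Groups" "HOL-Algebra.Product_Groups"
    "HOL-Algebra.Generated_Groups"
begin

section \<open>Minimal topological dynamical systems with acting group \<open>\<int>\<close>\<close>

definition tds :: "'a::metric_space set \<Rightarrow> ('a \<Rightarrow> 'a) \<Rightarrow> bool" where
  "tds X S \<longleftrightarrow> compact X \<and> (\<exists>S'. homeomorphism X X S S')"

text \<open>The map \<open>S\<close> is only relevant on \<open>X\<close>, so negative powers use the inverse of \<open>S\<close> on \<open>X\<close>.\<close>

definition zact :: "'a set \<Rightarrow> ('a \<Rightarrow> 'a) \<Rightarrow> int \<Rightarrow> 'a \<Rightarrow> 'a" where
  "zact X S n = (if n \<ge> 0 then S ^^ nat n else inv_into X S ^^ nat (- n))"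

definition zorbit :: "'a set \<Rightarrow> ('a \<Rightarrow> 'a) \<Rightarrow> 'a \<Rightarrow> 'a set" where
  "zorbit X S x = range (\<lambda>n. zact X S n x)"

definition minimal_tds :: "'a::metric_space set \<Rightarrow> ('a \<Rightarrow> 'a) \<Rightarrow> bool" where
  "minimal_tds X S \<longleftrightarrow> tds X S \<and> (\<forall>x\<in>X. closure (zorbit X S x) = X)"

definition tds_extension ::
  "'a::metric_space set \<Rightarrow> ('a \<Rightarrow> 'a) \<Rightarrow> 'b::metric_space set \<Rightarrow> ('b \<Rightarrow> 'b) \<Rightarrow> ('a \<Rightarrow> 'b) \<Rightarrow> bool" where
  "tds_extension X S Y R \<pi> \<longleftrightarrow>
     continuous_on X \<pi> \<and> \<pi> ` X = Y \<and> (\<forall>x\<in>X. \<pi> (S x) = R (\<pi> x))"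

section \<open>The face group\<close>

text \<open>The cube \<open>{0,1}\<^sup>d\<close> is represented by the subsets of \<open>{1..d}\<close>; cube-indexed
  tuples are extensional functions on it.\<close>

definition cube :: "nat \<Rightarrow> nat set set" where
  "cube d = Pow {1..d}"

definition upper_facet :: "nat \<Rightarrow> nat \<Rightarrow> nat set set" where
  "upper_facet d i = {\<epsilon> \<in> cube d. i \<in> \<epsilon>}"

definition cube_group :: "('g, 'm) monoid_scheme \<Rightarrow> nat \<Rightarrow> (nat set \<Rightarrow> 'g) monoid" where
  "cube_group T d = product_group (cube d) (\<lambda>_. T)"

text \<open>The element written \<open>t\<close> with superscript \<open>(\<alpha>)\<close>.\<close>

definition face_elt :: "('g, 'm) monoid_scheme \<Rightarrow> nat \<Rightarrow> 'g \<Rightarrow> nat set set \<Rightarrow> nat set \<Rightarrow> 'g" where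
  "face_elt T d t \<alpha> = (\<lambda>\<epsilon>\<in>cube d. if \<epsilon> \<in> \<alpha> then t else \<one>\<^bsub>T\<^esub>)"

definition face_group :: "('g, 'm) monoid_scheme \<Rightarrow> nat \<Rightarrow> (nat set \<Rightarrow> 'g) set" where
  "face_group T d =
     generate (cube_group T d) {face_elt T d t (upper_facet d i) | t i. t \<in> carrier T \<and> i \<in> {1..d}}"

section \<open>Regional proximality of order \<open>d\<close>\<close>

definition cube_topology :: "'a::topological_space set \<Rightarrow> nat \<Rightarrow> (nat set \<Rightarrow> 'a) topology" where
  "cube_topology X d = product_topology (\<lambda>_. top_of_set X) (cube d)"

definition cube_diag :: "nat \<Rightarrow> 'a \<Rightarrow> nat set \<Rightarrow> 'a" where
  "cube_diag d x = (\<lambda>\<epsilon>\<in>cube d. x)"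

definition cube_act ::
  "'a set \<Rightarrow> ('a \<Rightarrow> 'a) \<Rightarrow> nat \<Rightarrow> (nat set \<Rightarrow> int) \<Rightarrow> (nat set \<Rightarrow> 'a) \<Rightarrow> nat set \<Rightarrow> 'a" where
  "cube_act X S d f z = (\<lambda>\<epsilon>\<in>cube d. zact X S (f \<epsilon>) (z \<epsilon>))"

text \<open>A net of triples \<open>(f\<^sub>\<lambda>, x\<^sub>\<lambda>, y\<^sub>\<lambda>)\<close> is given by a proper filter \<open>F\<close> on
  triples, namely the one generated by the tails of the net; conversely, every proper filter
  arises from a net in this way.  The tuple \<open>a\<close> has one entry for each nonempty \<open>\<epsilon>\<close>, and
  \<open>a({} := x)\<close> is the point \<open>(x, a)\<close> of the cube space.\<close>

definition RP :: "'a::metric_space set \<Rightarrow> ('a \<Rightarrow> 'a) \<Rightarrow> nat \<Rightarrow> ('a \<times> 'a) set" where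
  "RP X S d = {(x, y). x \<in> X \<and> y \<in> X \<and>
     (\<exists>F. \<exists>a \<in> (cube d - {{}}) \<rightarrow>\<^sub>E X. F \<noteq> bot \<and>
        (\<forall>\<^sub>F (f, u, v) in F. f \<in> face_group integer_group d \<and> u \<in> X \<and> v \<in> X) \<and>
        limitin (prod_topology (cube_topology X d) (cube_topology X d))
          (\<lambda>(f, u, v). (cube_act X S d f (cube_diag d u), cube_act X S d f (cube_diag d v)))
          (a({} := x), a({} := y)) F)}"

end

(* The proof works in the enveloping semigroup.  Let u be a minimal idempotent of the enveloping
   semigroup of X fixing a point x2 over y2, and let Ug be the group of its elements p = u p u.
   The limits g of the Host-Kra cubes n |-> c + (sum of n_i over i in \<epsilon>) with entries in Ug form a
   group HK under pointwise composition, because the constant family u is again a minimal idempotent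
   of the semigroup of cubes; similarly for the limits HF of the face group.  A purely algebraic
   argument shows that a g in HK with g{} = u belongs to HF off {}.
   A pair (y1, y2) in RP(Y) yields a (d+1)-dimensional k in HK such that all entries of k except the
   one at {} stabilize y2, while k{} moves y2 to u y1.  Multiplying k by the inverses of its upper
   facets turns these entries into u without changing the images in Y.  Then HF contains a family
   that is \<beta> = (k{})^-1 off {}, and for any x1 over y1 the pair (x1, \<beta> x1) is in RP(X), over (y1, y2). *)
theory Submission
  imports Defs
begin

section \<open>Compact right topological semigroups\<close>

text \<open>A pair in \<open>RP\<close> of \<open>Y\<close> yields cubes over \<open>X\<close> whose
  matching entries agree only under \<open>\<pi>\<close>, whereas \<open>RP\<close> of
  \<open>X\<close> asks for the same tuple in both blocks. Limits of powers of \<open>S\<close> need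
  not be continuous, so the gap is closed by division rather than by a continuity argument, and a
  minimal idempotent is what makes division possible, in \<open>Ug\<close> and in the cubes over it.
  The price is that every entry is projected by \<open>u\<close>, while a point over
  \<open>y1\<close> need not be fixed by \<open>u\<close>. For this reason limits of the face group
  keep the identity, not \<open>u\<close>, at the vertex \<open>{}\<close>: such a family can be
  applied to an arbitrary \<open>x1\<close> and returns \<open>x1\<close> itself there. Vertices are
  arbitrary sets of naturals because passing from cubes to the face group consumes a direction that
  does not occur in the cube at hand; direction \<open>0\<close>, absent from \<open>cube d\<close>,
  separates the two points of a pair.\<close>

lemma open_coordinate_vimage:
  fixes U :: "'b::topological_space set"
  assumes "open U"
  shows "open {h :: 'a \<Rightarrow> 'b. h x \<in> U}"
proof -
  have "continuous_on UNIV (\<lambda>h :: 'a \<Rightarrow> 'b. h x)"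
    by (rule continuous_on_product_coordinates)
  then have "open ((\<lambda>h :: 'a \<Rightarrow> 'b. h x) -` U)"
    using assms open_vimage by blast
  then show ?thesis by (simp only: vimage_def)
qed

text \<open>The semigroup lemmas live in the class \<open>t2_space\<close> and are applied to maps
  and to families of maps; the class hierarchy demands the two weaker separation axioms
  first.\<close>

instance "fun" :: (type, t0_space) t0_space
proof
  fix f g :: "'a \<Rightarrow> 'b"
  assume "f \<noteq> g"
  then obtain x where "f x \<noteq> g x" by blast
  then obtain U where U: "open U" "\<not> (f x \<in> U \<longleftrightarrow> g x \<in> U)"
    using separation_t0[of "f x" "g x"] by blast
  show "\<exists>U. open U \<and> \<not> (f \<in> U \<longleftrightarrow> g \<in> U)"
    by (rule exI[of _ "{h. h x \<in> U}"]) (use open_coordinate_vimage U in simp)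
qed

instance "fun" :: (type, t1_space) t1_space
proof
  fix f g :: "'a \<Rightarrow> 'b"
  assume "f \<noteq> g"
  then obtain x where "f x \<noteq> g x" by blast
  then obtain U where U: "open U" "f x \<in> U" "g x \<notin> U"
    using separation_t1[of "f x" "g x"] by blast
  show "\<exists>U. open U \<and> f \<in> U \<and> g \<notin> U"
    by (rule exI[of _ "{h. h x \<in> U}"]) (use open_coordinate_vimage U in simp)
qed

instance "fun" :: (type, t2_space) t2_space
proof
  fix f g :: "'a \<Rightarrow> 'b"
  assume "f \<noteq> g"
  then obtain x where "f x \<noteq> g x" by blast
  then obtain U V where UV: "open U" "open V" "f x \<in> U" "g x \<in> V" "U \<inter> V = {}"
    using separation_t2[of "f x" "g x"] by blast
  show "\<exists>U V. open U \<and> open V \<and> f \<in> U \<and> g \<in> V \<and> U \<inter> V = {}"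
    by (rule exI[of _ "{h. h x \<in> U}"], rule exI[of _ "{h. h x \<in> V}"])
      (use open_coordinate_vimage UV in auto)
qed

lemma compact_PiE_UNIV:
  fixes K :: "'i \<Rightarrow> 'b::topological_space set"
  assumes "\<And>i. compact (K i)"
  shows "compact {f. \<forall>i. f i \<in> K i}"
proof -
  have "PiE UNIV K = {f. \<forall>i. f i \<in> K i}" by (auto simp: PiE_def Pi_def)
  then show ?thesis
    using assms compactin_PiE[of "\<lambda>_. euclidean" UNIV K, unfolded euclidean_product_topology]
    by auto
qed

text \<open>Zorn's lemma for reverse inclusion: by compactness the intersection of a chain stays
  nonempty. The family \<open>A\<close> is a parameter because both closed subsemigroups and closed
  left ideals are minimized.\<close>

lemma minimal_closed_set:
  fixes A :: "'b::topological_space set set"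
  assumes "compact K" "K \<in> A" and A: "\<And>B. B \<in> A \<Longrightarrow> closed B \<and> B \<noteq> {}"
    and inter: "\<And>C. \<lbrakk>C \<noteq> {}; C \<subseteq> A; \<Inter>C \<noteq> {}\<rbrakk> \<Longrightarrow> \<Inter>C \<in> A"
  obtains M where "M \<in> A" "M \<subseteq> K" "\<And>B. \<lbrakk>B \<in> A; B \<subseteq> M\<rbrakk> \<Longrightarrow> B = M"
proof -
  let ?P = "\<lambda>B C. C \<subseteq> B" and ?A = "{B \<in> A. B \<subseteq> K}"
  have "\<exists>m\<in>?A. \<forall>a\<in>?A. ?P m a \<longrightarrow> a = m"
  proof (rule predicate_Zorn)
    show "partial_order_on ?A (relation_of ?P ?A)"
      by (auto simp: partial_order_on_def preorder_on_def refl_on_def trans_def antisym_def relation_of_def)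
    fix C assume C: "C \<in> Chains (relation_of ?P ?A)"
    then have sub: "C \<subseteq> ?A" and lin: "\<And>B B'. \<lbrakk>B \<in> C; B' \<in> C\<rbrakk> \<Longrightarrow> B \<subseteq> B' \<or> B' \<subseteq> B"
      by (auto simp: Chains_def relation_of_def)
    show "\<exists>u\<in>?A. \<forall>a\<in>C. ?P a u"
    proof (cases "C = {}")
      case True then show ?thesis using \<open>K \<in> A\<close> by auto
    next
      case False
      have fin: "\<exists>B\<in>C. \<Inter>F = B" if "finite F" "F \<noteq> {}" "F \<subseteq> C" for F
        using that
      proof (induction F rule: finite_ne_induct)
        case (insert B F)
        then obtain B' where "B' \<in> C" "\<Inter>F = B'" by auto
        then show ?case using insert lin[of B B'] by (auto simp: Int_absorb1 Int_absorb2)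
      qed auto
      have "K \<inter> \<Inter>C \<noteq> {}"
      proof (rule compact_imp_fip[OF \<open>compact K\<close>])
        show "closed T" if "T \<in> C" for T using that sub A by auto
        show "K \<inter> \<Inter>F \<noteq> {}" if "finite F" "F \<subseteq> C" for F
        proof (cases "F = {}")
          case True then show ?thesis using A[OF \<open>K \<in> A\<close>] by auto
        next
          case False
          then obtain B where "B \<in> C" "\<Inter>F = B" using fin \<open>finite F\<close> \<open>F \<subseteq> C\<close> by metis
          then have "B \<subseteq> K" "B \<noteq> {}" using sub A by blast+
          then show ?thesis using \<open>\<Inter>F = B\<close> by blast
        qed
      qed
      then have "\<Inter>C \<in> ?A" using inter[OF False] sub False by auto
      then show ?thesis by auto
    qed
  qed
  then obtain M where "M \<in> ?A" "\<And>B. \<lbrakk>B \<in> ?A; B \<subseteq> M\<rbrakk> \<Longrightarrow> B = M" by blast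
  then show ?thesis using that[of M] by blast
qed

text \<open>The Ellis--Numakura lemma.\<close>

lemma idempotent_exists:
  fixes E :: "'p::t2_space set" and f :: "'p \<Rightarrow> 'p \<Rightarrow> 'p"
  assumes "compact E" "E \<noteq> {}"
    and clos: "\<And>p q. \<lbrakk>p \<in> E; q \<in> E\<rbrakk> \<Longrightarrow> f p q \<in> E"
    and assoc: "\<And>p q r. f (f p q) r = f p (f q r)"
    and cont: "\<And>q. q \<in> E \<Longrightarrow> continuous_on E (\<lambda>p. f p q)"
  obtains e where "e \<in> E" "f e e = e"
proof -
  let ?A = "{B. closed B \<and> B \<noteq> {} \<and> B \<subseteq> E \<and> (\<forall>p\<in>B. \<forall>q\<in>B. f p q \<in> B)}"
  obtain M where M: "M \<in> ?A" and "M \<subseteq> E" and min: "\<And>B. \<lbrakk>B \<in> ?A; B \<subseteq> M\<rbrakk> \<Longrightarrow> B = M"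
  proof (rule minimal_closed_set[of E ?A])
    show "E \<in> ?A" using assms by (auto simp: compact_imp_closed)
    fix C assume "C \<noteq> {}" "C \<subseteq> ?A" "\<Inter>C \<noteq> {}"
    moreover from this have "closed (\<Inter>C)" "\<Inter>C \<subseteq> E" by (blast intro: closed_Inter)+
    ultimately show "\<Inter>C \<in> ?A" by blast
  qed (use \<open>compact E\<close> in auto)
  then obtain e where "e \<in> M" by auto
  have "compact M" using compact_Int_closed[OF \<open>compact E\<close>, of M] M by (simp add: Int_absorb1)
  have contM: "continuous_on M (\<lambda>p. f p e)"
    using cont \<open>e \<in> M\<close> \<open>M \<subseteq> E\<close> continuous_on_subset by blast
  \<comment> \<open>Right translation is the continuous one, so this image is closed; being a
    subsemigroup inside \<open>M\<close>, it exhausts \<open>M\<close> and therefore contains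
    \<open>e\<close>.\<close>
  have "(\<lambda>p. f p e) ` M = M"
  proof (rule min)
    have "closed ((\<lambda>p. f p e) ` M)"
      using compact_continuous_image[OF contM \<open>compact M\<close>] compact_imp_closed by blast
    moreover have "f (f p e) (f q e) \<in> (\<lambda>p. f p e) ` M" if "p \<in> M" "q \<in> M" for p q
      using that M \<open>e \<in> M\<close> by (intro image_eqI[of _ _ "f (f p e) q"]) (auto simp: assoc)
    moreover show "(\<lambda>p. f p e) ` M \<subseteq> M" using M \<open>e \<in> M\<close> by auto
    ultimately show "(\<lambda>p. f p e) ` M \<in> ?A" using M \<open>M \<subseteq> E\<close> by blast
  qed
  then obtain a where "a \<in> M" "f a e = e" using \<open>e \<in> M\<close> by (metis (no_types, lifting) imageE)
  \<comment> \<open>The solutions of \<open>f p e = e\<close> form a closed subsemigroup, nonempty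
    because of \<open>a\<close>; minimality puts \<open>e\<close> itself among them.\<close>
  let ?B = "M \<inter> (\<lambda>p. f p e) -` {e}"
  have "?B = M"
  proof (rule min)
    have "closed ?B"
      using continuous_closed_preimage[OF contM, of "{e}"] M by (simp add: closed_singleton)
    moreover have "f p q \<in> ?B" if "p \<in> ?B" "q \<in> ?B" for p q
      using that M by (auto simp: assoc)
    ultimately show "?B \<in> ?A" using M \<open>a \<in> M\<close> \<open>f a e = e\<close> by auto
  qed auto
  then have "f e e = e" using \<open>e \<in> M\<close> by auto
  then show ?thesis using that \<open>e \<in> M\<close> \<open>M \<subseteq> E\<close> by auto
qed

text \<open>The idempotent \<open>u\<close> is taken from a minimal left ideal \<open>L\<close>: if \<open>v = f p u\<close> is idempotent, then
  \<open>L v = L\<close>, so \<open>v\<close> is a right identity of \<open>L\<close>.\<close>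

lemma minimal_idempotent_exists:
  fixes E :: "'p::t2_space set" and f :: "'p \<Rightarrow> 'p \<Rightarrow> 'p"
  assumes "compact E" "E \<noteq> {}"
    and clos: "\<And>p q. \<lbrakk>p \<in> E; q \<in> E\<rbrakk> \<Longrightarrow> f p q \<in> E"
    and assoc: "\<And>p q r. f (f p q) r = f p (f q r)"
    and cont: "\<And>q. q \<in> E \<Longrightarrow> continuous_on E (\<lambda>p. f p q)"
    and D: "closed D" "\<And>p q. \<lbrakk>p \<in> D; q \<in> D\<rbrakk> \<Longrightarrow> f p q \<in> D"
      "\<And>p. p \<in> E \<Longrightarrow> \<exists>q\<in>E. f q p \<in> D"
  obtains u where "u \<in> E" "u \<in> D" "f u u = u"
    "\<And>p. \<lbrakk>p \<in> E; f (f p u) (f p u) = f p u\<rbrakk> \<Longrightarrow> f u (f p u) = u"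
proof -
  let ?A = "{B. closed B \<and> B \<noteq> {} \<and> B \<subseteq> E \<and> (\<forall>p\<in>E. \<forall>q\<in>B. f p q \<in> B)}"
  obtain L where L: "L \<in> ?A" and "L \<subseteq> E" and min: "\<And>B. \<lbrakk>B \<in> ?A; B \<subseteq> L\<rbrakk> \<Longrightarrow> B = L"
  proof (rule minimal_closed_set[of E ?A])
    show "E \<in> ?A" using assms by (auto simp: compact_imp_closed)
    fix C assume "C \<noteq> {}" "C \<subseteq> ?A" "\<Inter>C \<noteq> {}"
    moreover from this have "closed (\<Inter>C)" "\<Inter>C \<subseteq> E" by (blast intro: closed_Inter)+
    ultimately show "\<Inter>C \<in> ?A" by blast
  qed (use \<open>compact E\<close> in auto)
  then obtain a where "a \<in> L" by auto
  then obtain b where "b \<in> E" "f b a \<in> D" using D(3) \<open>L \<subseteq> E\<close> by blast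
  \<comment> \<open>\<open>f b a\<close> lies in \<open>D\<close> and in the left ideal
    \<open>L\<close>, so \<open>L \<inter> D\<close> is a nonempty compact subsemigroup and has an
    idempotent.\<close>
  have "compact (L \<inter> D)"
    using compact_Int_closed[OF \<open>compact E\<close>, of "L \<inter> D"] L D(1) by (simp add: closed_Int Int_absorb1 le_infI1)
  then obtain u where u: "u \<in> L \<inter> D" "f u u = u"
  proof (rule idempotent_exists[where f = f])
    show "L \<inter> D \<noteq> {}" using L \<open>a \<in> L\<close> \<open>b \<in> E\<close> \<open>f b a \<in> D\<close> by auto
    show "f p q \<in> L \<inter> D" if "p \<in> L \<inter> D" "q \<in> L \<inter> D" for p q
      using that L D(2) by auto
    show "continuous_on (L \<inter> D) (\<lambda>p. f p q)" if "q \<in> L \<inter> D" for q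
      using that cont[of q] \<open>L \<subseteq> E\<close> by (meson Int_iff Int_lower1 continuous_on_subset order_trans subsetD)
  qed (auto simp: assoc)
  show ?thesis
  proof
    fix p assume p: "p \<in> E" "f (f p u) (f p u) = f p u"
    let ?v = "f p u"
    have "?v \<in> L" using p u L by auto
    have "(\<lambda>l. f l ?v) ` E = L"
    proof (rule min)
      have "?v \<in> E" using \<open>?v \<in> L\<close> \<open>L \<subseteq> E\<close> by auto
      then have "closed ((\<lambda>l. f l ?v) ` E)"
        using cont compact_continuous_image \<open>compact E\<close> compact_imp_closed by blast
      moreover show "(\<lambda>l. f l ?v) ` E \<subseteq> L" using L \<open>?v \<in> L\<close> by auto
      moreover have "f p (f q ?v) \<in> (\<lambda>l. f l ?v) ` E" if "p \<in> E" "q \<in> E" for p q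
        using clos[OF that] by (intro image_eqI[of _ _ "f p q"]) (auto simp: assoc)
      ultimately show "(\<lambda>l. f l ?v) ` E \<in> ?A"
        using \<open>E \<noteq> {}\<close> \<open>L \<subseteq> E\<close> by blast
    qed
    then obtain l where "u = f l ?v" using u by auto
    \<comment> \<open>\<open>f u ?v = f l (f ?v ?v) = f l ?v = u\<close>.\<close>
    then show "f u ?v = u" using p(2) assoc by metis
  qed (use u \<open>L \<subseteq> E\<close> in auto)
qed

section \<open>Enveloping semigroups of cube actions\<close>

text \<open>The exponents of the face group, for cubes with infinitely many directions: the constructions
  below need directions besides \<open>1, \<dots>, d\<close>.\<close>

inductive_set lin :: "(nat set \<Rightarrow> int) set" where
  zero: "(\<lambda>_. 0) \<in> lin"
| face: "a \<in> lin \<Longrightarrow> (\<lambda>\<epsilon>. a \<epsilon> + (if i \<in> \<epsilon> then k else 0)) \<in> lin"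

lemma lin_add: "b \<in> lin \<Longrightarrow> a \<in> lin \<Longrightarrow> (\<lambda>\<epsilon>. a \<epsilon> + b \<epsilon>) \<in> lin"
proof (induction b rule: lin.induct)
  case (face b i k)
  then show ?case using lin.face[of "\<lambda>\<epsilon>. a \<epsilon> + b \<epsilon>" i k] by (simp add: add.assoc)
qed simp

lemma lin_empty: "a \<in> lin \<Longrightarrow> a {} = 0"
  by (induction a rule: lin.induct) auto

lemma lin_Un: "a \<in> lin \<Longrightarrow> \<epsilon> \<inter> \<delta> = {} \<Longrightarrow> a (\<epsilon> \<union> \<delta>) = a \<epsilon> + a \<delta>"
  by (induction a rule: lin.induct) auto

text \<open>Each coordinate of \<open>\<phi> \<epsilon>\<close> copies a coordinate of \<epsilon> or
  is constantly 0 or 1. Face inclusions, projections and duplications of directions are of this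
  kind. A coordinate that is constantly 1 adds a constant to a face exponent.\<close>

definition affine_reindex :: "(nat set \<Rightarrow> nat set) \<Rightarrow> bool" where
  "affine_reindex \<phi> \<longleftrightarrow> (\<forall>i. (\<exists>j. \<forall>\<epsilon>. i \<in> \<phi> \<epsilon> \<longleftrightarrow> j \<in> \<epsilon>) \<or> (\<forall>\<epsilon>. i \<notin> \<phi> \<epsilon>) \<or> (\<forall>\<epsilon>. i \<in> \<phi> \<epsilon>))"

lemma affine_reindex_Int: "affine_reindex (\<lambda>\<epsilon>. \<epsilon> \<inter> A)"
  by (auto simp: affine_reindex_def)

lemma affine_reindex_Diff: "affine_reindex (\<lambda>\<epsilon>. \<epsilon> - A)"
  using affine_reindex_Int[of "- A"] by (simp add: Diff_eq)

lemma affine_reindex_insert: "affine_reindex (insert i)"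
  unfolding affine_reindex_def by (metis insert_iff)

text \<open>For \<open>m \<noteq> n\<close>, direction \<open>n\<close> is renamed to
  \<open>m\<close> and then left empty. This lets \<open>HF_facet\<close> read a family along
  \<open>m\<close> instead of \<open>n\<close>.\<close>

lemma affine_reindex_move: "affine_reindex (\<lambda>\<epsilon>. if n \<in> \<epsilon> then insert m (\<epsilon> - {n}) else \<epsilon> - {m})"
  unfolding affine_reindex_def
proof
  fix i
  let ?\<phi> = "\<lambda>\<epsilon>. if n \<in> \<epsilon> then insert m (\<epsilon> - {n}) else \<epsilon> - {m}"
  consider "i = m" | "i \<noteq> m" "i = n" | "i \<noteq> m" "i \<noteq> n" by blast
  then show "(\<exists>j. \<forall>\<epsilon>. i \<in> ?\<phi> \<epsilon> \<longleftrightarrow> j \<in> \<epsilon>) \<or> (\<forall>\<epsilon>. i \<notin> ?\<phi> \<epsilon>) \<or> (\<forall>\<epsilon>. i \<in> ?\<phi> \<epsilon>)"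
  proof cases
    case 1
    then have "\<forall>\<epsilon>. i \<in> ?\<phi> \<epsilon> \<longleftrightarrow> n \<in> \<epsilon>" by simp
    then show ?thesis by blast
  next
    case 2
    then show ?thesis by simp
  next
    case 3
    then have "\<forall>\<epsilon>. i \<in> ?\<phi> \<epsilon> \<longleftrightarrow> i \<in> \<epsilon>" by simp
    then show ?thesis by blast
  qed
qed

lemma lin_affine_reindex:
  assumes "affine_reindex \<phi>" "a \<in> lin"
  shows "\<exists>b\<in>lin. \<exists>c. \<forall>\<epsilon>. a (\<phi> \<epsilon>) = c + b \<epsilon>"
  using assms(2)
proof (induction a rule: lin.induct)
  case zero
  show ?case by (intro bexI[OF _ lin.zero] exI[of _ 0]) simp
next
  case (face a i k)
  then obtain b c where b: "b \<in> lin" "\<And>\<epsilon>. a (\<phi> \<epsilon>) = c + b \<epsilon>" by auto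
  consider j where "\<forall>\<epsilon>. i \<in> \<phi> \<epsilon> \<longleftrightarrow> j \<in> \<epsilon>" | "\<forall>\<epsilon>. i \<notin> \<phi> \<epsilon>" | "\<forall>\<epsilon>. i \<in> \<phi> \<epsilon>"
    using assms(1) unfolding affine_reindex_def by metis
  then show ?case
  proof cases
    case 1
    then show ?thesis using b lin.face[OF b(1), of j k]
      by (intro bexI[of _ "\<lambda>\<epsilon>. b \<epsilon> + (if j \<in> \<epsilon> then k else 0)"] exI[of _ c]) auto
  next
    case 2
    then show ?thesis using b by (intro bexI[OF _ b(1)] exI[of _ c]) auto
  next
    case 3
    then show ?thesis using b by (intro bexI[OF _ b(1)] exI[of _ "c + k"]) auto
  qed
qed

lemma lin_affine_reindex0:
  assumes "affine_reindex \<phi>" "\<phi> {} = {}" "a \<in> lin"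
  shows "(\<lambda>\<epsilon>. a (\<phi> \<epsilon>)) \<in> lin"
proof -
  obtain b c where b: "b \<in> lin" "\<And>\<epsilon>. a (\<phi> \<epsilon>) = c + b \<epsilon>"
    using lin_affine_reindex[OF assms(1,3)] by blast
  then have "c = 0" using lin_empty[OF \<open>b \<in> lin\<close>] lin_empty[OF \<open>a \<in> lin\<close>] b(2)[of "{}"] assms(2) by simp
  then have "(\<lambda>\<epsilon>. a (\<phi> \<epsilon>)) = b" using b(2) by auto
  then show ?thesis using b(1) by simp
qed

definition fam_comp :: "('i \<Rightarrow> 'a \<Rightarrow> 'a) \<Rightarrow> ('i \<Rightarrow> 'a \<Rightarrow> 'a) \<Rightarrow> 'i \<Rightarrow> 'a \<Rightarrow> 'a" (infixl "\<bullet>\<bullet>" 70) where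
  "p \<bullet>\<bullet> q = (\<lambda>\<epsilon>. p \<epsilon> \<circ> q \<epsilon>)"

lemma fam_comp_assoc: "(p \<bullet>\<bullet> q) \<bullet>\<bullet> r = p \<bullet>\<bullet> (q \<bullet>\<bullet> r)"
  by (simp add: fam_comp_def o_assoc)

lemma continuous_on_coordinates: "continuous_on A (\<lambda>p. p \<epsilon> x)"
  by (rule continuous_on_product_then_coordinatewise, rule continuous_on_product_then_coordinatewise)
     (rule continuous_on_id)

lemma continuous_on_fam_comp_left: "continuous_on A (\<lambda>p. p \<bullet>\<bullet> q)"
  unfolding fam_comp_def o_def
  by (rule continuous_on_coordinatewise_then_product, rule continuous_on_coordinatewise_then_product)
    (rule continuous_on_coordinates)

lemma continuous_on_reindex: "continuous_on A (\<lambda>p \<epsilon>. p (\<phi> \<epsilon>))"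
  by (rule continuous_on_coordinatewise_then_product)
    (rule continuous_on_product_then_coordinatewise[OF continuous_on_id])

section \<open>Integer powers of a homeomorphism of a compact space\<close>

locale cascade =
  fixes X :: "'a::metric_space set" and S :: "'a \<Rightarrow> 'a"
  assumes tds: "tds X S"
begin

lemma compact_X: "compact X"
  using tds by (simp add: tds_def)

lemma S_homeomorphism: "homeomorphism X X S (inv_into X S)"
proof -
  obtain S' where S': "homeomorphism X X S S'" using tds by (auto simp: tds_def)
  then have "inj_on S X" by (metis homeomorphism_def inj_on_inverseI)
  have "inv_into X S y = S' y" if "y \<in> X" for y
    using S' that \<open>inj_on S X\<close> by (metis homeomorphism_def image_eqI inv_into_f_eq)
  then show ?thesis using S' by (metis homeomorphism_cong)
qed

text \<open>Extended by the identity off \<open>X\<close>, so that \<open>T_add\<close> is an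
  equation between total functions and families can be composed without side conditions.\<close>

definition T :: "int \<Rightarrow> 'a \<Rightarrow> 'a" where
  "T n = (\<lambda>x. if x \<in> X then zact X S n x else x)"

lemma S_in: "x \<in> X \<Longrightarrow> S x \<in> X"
  using homeomorphism_image1[OF S_homeomorphism] by blast

lemma S_inv_in: "x \<in> X \<Longrightarrow> inv_into X S x \<in> X"
  using homeomorphism_image2[OF S_homeomorphism] by blast

lemma S_inv: "x \<in> X \<Longrightarrow> S (inv_into X S x) = x"
  by (rule homeomorphism_apply2[OF S_homeomorphism])

lemma inv_S: "x \<in> X \<Longrightarrow> inv_into X S (S x) = x"
  by (rule homeomorphism_apply1[OF S_homeomorphism])

lemma zact_int: "zact X S (int k) = S ^^ k"
  by (simp add: zact_def)

lemma zact_neg_int: "zact X S (- int k) = inv_into X S ^^ k"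
  by (cases "k = 0") (simp_all add: zact_def)

lemma inv_pow_in: "x \<in> X \<Longrightarrow> (inv_into X S ^^ k) x \<in> X"
  by (induction k) (auto simp: S_inv_in)

lemma pow_in: "x \<in> X \<Longrightarrow> (S ^^ k) x \<in> X"
  by (induction k) (auto simp: S_in)

lemma zact_in:
  assumes "x \<in> X"
  shows "zact X S n x \<in> X"
proof (cases n rule: int_cases2)
  case (nonneg k)
  show ?thesis unfolding nonneg zact_int using pow_in[OF assms] .
next
  case (nonpos k)
  show ?thesis unfolding nonpos zact_neg_int using inv_pow_in[OF assms] .
qed

lemma zact_Suc:
  assumes "x \<in> X"
  shows "zact X S (n + 1) x = S (zact X S n x)"
proof (cases n)
  case (nonneg k)
  have "n + 1 = int (Suc k)" using nonneg by simp
  then have "zact X S (n + 1) x = (S ^^ Suc k) x" by (simp only: zact_int)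
  then show ?thesis unfolding nonneg(1) zact_int by simp
next
  case (neg k)
  have "n + 1 = - int k" using neg by simp
  then have "zact X S (n + 1) x = (inv_into X S ^^ k) x" by (simp only: zact_neg_int)
  then show ?thesis unfolding neg zact_neg_int by (simp add: S_inv inv_pow_in assms)
qed

lemma zact_add:
  assumes "x \<in> X"
  shows "zact X S (m + n) x = zact X S m (zact X S n x)"
proof (induction m rule: int_induct[of _ 0])
  case base
  have "zact X S 0 = id" using zact_int[of 0] by simp
  then show ?case by simp
next
  case (step1 m)
  have "zact X S (m + 1 + n) x = S (zact X S (m + n) x)"
    using zact_Suc[OF assms, of "m + n"] by (simp add: add.commute add.left_commute)
  also have "\<dots> = zact X S (m + 1) (zact X S n x)"
    unfolding step1(2) zact_Suc[OF zact_in[OF assms]] ..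
  finally show ?case .
next
  case (step2 m)
  have "S (zact X S (m - 1 + n) x) = zact X S (m + n) x"
    using zact_Suc[OF assms, of "m - 1 + n"] by (simp add: algebra_simps)
  also have "\<dots> = S (zact X S (m - 1) (zact X S n x))"
    using zact_Suc[OF zact_in[OF assms], of "m - 1" n] step2(2) by simp
  finally have "inv_into X S (S (zact X S (m - 1 + n) x)) = inv_into X S (S (zact X S (m - 1) (zact X S n x)))"
    by simp
  then show ?case by (simp add: inv_S zact_in assms)
qed

lemma T_0: "T 0 = id"
  using zact_int[of 0] by (simp add: T_def fun_eq_iff)

lemma T_in: "x \<in> X \<Longrightarrow> T n x \<in> X" by (simp add: T_def zact_in)

lemma T_outside: "x \<notin> X \<Longrightarrow> T n x = x" by (simp add: T_def)

lemma T_add: "T (m + n) = T m \<circ> T n"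
proof
  fix x show "T (m + n) x = (T m \<circ> T n) x"
    by (cases "x \<in> X") (simp_all add: T_def zact_add zact_in)
qed

lemma continuous_on_T: "continuous_on X (T n)"
proof (induction n rule: int_induct[of _ 0])
  case base
  then show ?case by (simp add: T_0 id_def)
next
  case (step1 n)
  have "continuous_on X S" using S_homeomorphism by (simp add: homeomorphism_def)
  then have "continuous_on X (\<lambda>x. S (T n x))"
    by (rule continuous_on_compose2[OF _ step1(2)]) (use T_in in blast)
  then show ?case
    by (rule continuous_on_eq) (simp add: T_def zact_Suc)
next
  case (step2 n)
  have "continuous_on X (inv_into X S)" using S_homeomorphism by (simp add: homeomorphism_def)
  then have "continuous_on X (\<lambda>x. inv_into X S (T n x))"
    by (rule continuous_on_compose2[OF _ step2(2)]) (use T_in in blast)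
  moreover have "inv_into X S (T n x) = T (n - 1) x" if "x \<in> X" for x
    using zact_Suc[OF that, of "n - 1"] that by (simp add: T_def inv_S zact_in)
  ultimately show ?case by (rule continuous_on_eq)
qed

section \<open>The face group, the cube group and their limits\<close>

definition F :: "(nat set \<Rightarrow> 'a \<Rightarrow> 'a) set" where
  "F = {\<lambda>\<epsilon>. T (a \<epsilon>) |a. a \<in> lin}"

text \<open>The face group enlarged by the diagonal action: the constant frees the vertex
  \<open>{}\<close>, at which members of \<open>F\<close> are the identity.\<close>

definition G :: "(nat set \<Rightarrow> 'a \<Rightarrow> 'a) set" where
  "G = {\<lambda>\<epsilon>. T (c + a \<epsilon>) |a c. a \<in> lin}"

lemma F_I: "a \<in> lin \<Longrightarrow> (\<lambda>\<epsilon>. T (a \<epsilon>)) \<in> F"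
  unfolding F_def mem_Collect_eq by (rule exI[of _ a]) simp

lemma G_I: "a \<in> lin \<Longrightarrow> (\<lambda>\<epsilon>. T (c + a \<epsilon>)) \<in> G"
  unfolding G_def mem_Collect_eq by (rule exI[of _ a], rule exI[of _ c]) simp

text \<open>The whole type need not be compact. Tychonoff's theorem applies to the families that
  preserve \<open>X\<close> and fix every other point, and all limits are taken inside this
  set.\<close>

definition W :: "(nat set \<Rightarrow> 'a \<Rightarrow> 'a) set" where
  "W = {p. \<forall>\<epsilon>. p \<epsilon> \<in> {f. \<forall>x. f x \<in> (if x \<in> X then X else {x})}}"

lemma compact_W: "compact W"
proof -
  have "compact (if x \<in> X then X else {x})" for x by (simp add: compact_X)
  then have "compact {f. \<forall>x. f x \<in> (if x \<in> X then X else {x})}"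
    by (rule compact_PiE_UNIV)
  then show ?thesis unfolding W_def by (rule compact_PiE_UNIV)
qed

lemma W_in: "p \<in> W \<Longrightarrow> x \<in> X \<Longrightarrow> p \<epsilon> x \<in> X"
  and W_outside: "p \<in> W \<Longrightarrow> x \<notin> X \<Longrightarrow> p \<epsilon> x = x"
proof -
  assume "p \<in> W"
  then have *: "p \<epsilon> x \<in> (if x \<in> X then X else {x})" for \<epsilon> x
    unfolding W_def mem_Collect_eq by simp
  show "x \<in> X \<Longrightarrow> p \<epsilon> x \<in> X" "x \<notin> X \<Longrightarrow> p \<epsilon> x = x"
    using *[of \<epsilon> x] by auto
qed

lemma F_subset_G: "F \<subseteq> G"
proof
  fix h assume "h \<in> F"
  then obtain a where "a \<in> lin" "h = (\<lambda>\<epsilon>. T (a \<epsilon>))" unfolding F_def by blast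
  then show "h \<in> G" using G_I[of a 0] by simp
qed

lemma G_subset_W: "G \<subseteq> W"
proof
  fix h assume "h \<in> G"
  then obtain a c where "h = (\<lambda>\<epsilon>. T (c + a \<epsilon>))" unfolding G_def by blast
  then show "h \<in> W" by (simp add: W_def T_in T_outside)
qed

lemma F_comp: "p \<in> F \<Longrightarrow> q \<in> F \<Longrightarrow> p \<bullet>\<bullet> q \<in> F"
proof -
  assume "p \<in> F" "q \<in> F"
  then obtain a b where ab: "a \<in> lin" "b \<in> lin" "p = (\<lambda>\<epsilon>. T (a \<epsilon>))" "q = (\<lambda>\<epsilon>. T (b \<epsilon>))"
    unfolding F_def by blast
  then have "p \<bullet>\<bullet> q = (\<lambda>\<epsilon>. T (a \<epsilon> + b \<epsilon>))"
    unfolding fam_comp_def by (simp add: T_add[symmetric])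
  then show ?thesis using F_I[OF lin_add[OF ab(2,1)]] by simp
qed

lemma G_comp: "p \<in> G \<Longrightarrow> q \<in> G \<Longrightarrow> p \<bullet>\<bullet> q \<in> G"
proof -
  assume "p \<in> G" "q \<in> G"
  then obtain a b c d where ab: "a \<in> lin" "b \<in> lin" "p = (\<lambda>\<epsilon>. T (c + a \<epsilon>))" "q = (\<lambda>\<epsilon>. T (d + b \<epsilon>))"
    unfolding G_def by auto
  then have "p \<bullet>\<bullet> q = (\<lambda>\<epsilon>. T ((c + d) + (a \<epsilon> + b \<epsilon>)))"
    unfolding fam_comp_def by (simp add: T_add[symmetric] algebra_simps)
  then show ?thesis using G_I[OF lin_add[OF ab(2,1)], of "c + d"] by simp
qed

text \<open>The closure is taken for whole families, pointwise in the vertex and in the point; the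
  entries at different vertices are thus limits along a common net.\<close>

definition EF where "EF = closure F"
definition EG where "EG = closure G"

lemma closure_subset_W: "H \<subseteq> G \<Longrightarrow> closure H \<subseteq> W"
  using closure_minimal[OF order_trans[OF _ G_subset_W] compact_imp_closed[OF compact_W]] .

lemma EG_subset_W: "EG \<subseteq> W" and EF_subset_EG: "EF \<subseteq> EG"
  unfolding EG_def EF_def using closure_subset_W[OF order_refl] closure_mono[OF F_subset_G] by - assumption+

lemma compact_closure:
  assumes "H \<subseteq> G"
  shows "compact (closure H)"
  using compact_Int_closed[OF compact_W closed_closure, of H]
  unfolding Int_absorb1[OF closure_subset_W[OF assms]] .

lemma compact_EG: "compact EG" and compact_EF: "compact EF"
  unfolding EG_def EF_def using compact_closure[OF order_refl] compact_closure[OF F_subset_G] by - assumption+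

text \<open>Composition is continuous in its right argument when the left one consists of powers of
  \<open>S\<close>; for limits of such families this may fail.\<close>

lemma continuous_on_fam_comp_right:
  assumes "h \<in> G"
  shows "continuous_on W (\<lambda>q. h \<bullet>\<bullet> q)"
proof -
  obtain a c where h: "h = (\<lambda>\<epsilon>. T (c + a \<epsilon>))" using assms unfolding G_def by blast
  have "continuous_on W (\<lambda>q. T n (q \<epsilon> x))" for n \<epsilon> x
  proof (cases "x \<in> X")
    case True
    then have "(\<lambda>q. q \<epsilon> x) ` W \<subseteq> X" using W_in by blast
    then show ?thesis
      by (rule continuous_on_compose2[OF continuous_on_T continuous_on_coordinates])
  next
    case False
    have "continuous_on W (\<lambda>_. T n x)" by (rule continuous_on_const)
    then show ?thesis
      by (rule continuous_on_eq) (simp add: False W_outside)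
  qed
  then show ?thesis unfolding h fam_comp_def o_def
    by (rule continuous_on_coordinatewise_then_product[OF continuous_on_coordinatewise_then_product])
qed

text \<open>The two limits are taken one after the other: first in \<open>q\<close>, with the left
  factor in \<open>H\<close> and hence continuous, then in \<open>p\<close>, where continuity always
  holds.\<close>

lemma closure_comp:
  assumes "H \<subseteq> G" and comp: "\<And>p q. p \<in> H \<Longrightarrow> q \<in> H \<Longrightarrow> p \<bullet>\<bullet> q \<in> H"
    and "p \<in> closure H" "q \<in> closure H"
  shows "p \<bullet>\<bullet> q \<in> closure H"
proof -
  have "h \<bullet>\<bullet> q \<in> closure H" if "h \<in> H" for h
  proof -
    have "continuous_on (closure H) (\<lambda>q. h \<bullet>\<bullet> q)"
      using continuous_on_subset[OF continuous_on_fam_comp_right[of h] closure_subset_W[OF \<open>H \<subseteq> G\<close>]]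
        that \<open>H \<subseteq> G\<close> by blast
    moreover have "(\<lambda>q. h \<bullet>\<bullet> q) ` H \<subseteq> closure H"
      using comp that closure_subset by blast
    ultimately have "(\<lambda>q. h \<bullet>\<bullet> q) ` closure H \<subseteq> closure H"
      using image_closure_subset[OF _ closed_closure] by blast
    then show ?thesis using assms by blast
  qed
  then have "(\<lambda>p. p \<bullet>\<bullet> q) ` H \<subseteq> closure H" by blast
  then have "(\<lambda>p. p \<bullet>\<bullet> q) ` closure H \<subseteq> closure H"
    by (rule image_closure_subset[OF continuous_on_fam_comp_left closed_closure])
  then show ?thesis using assms by blast
qed

lemma EF_comp: "p \<in> EF \<Longrightarrow> q \<in> EF \<Longrightarrow> p \<bullet>\<bullet> q \<in> EF"
  unfolding EF_def using closure_comp[OF F_subset_G F_comp] .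

lemma EG_comp: "p \<in> EG \<Longrightarrow> q \<in> EG \<Longrightarrow> p \<bullet>\<bullet> q \<in> EG"
  unfolding EG_def using closure_comp[OF order_refl G_comp] .

lemma EG_reindex:
  assumes "affine_reindex \<phi>" "p \<in> EG"
  shows "(\<lambda>\<epsilon>. p (\<phi> \<epsilon>)) \<in> EG"
proof -
  have "(\<lambda>\<epsilon>. h (\<phi> \<epsilon>)) \<in> G" if "h \<in> G" for h
  proof -
    from that obtain a c where a: "a \<in> lin" "h = (\<lambda>\<epsilon>. T (c + a \<epsilon>))" unfolding G_def by auto
    obtain b c' where "b \<in> lin" "\<And>\<epsilon>. a (\<phi> \<epsilon>) = c' + b \<epsilon>"
      using lin_affine_reindex[OF assms(1) a(1)] by blast
    then have "(\<lambda>\<epsilon>. h (\<phi> \<epsilon>)) = (\<lambda>\<epsilon>. T ((c + c') + b \<epsilon>))" using a by (simp add: algebra_simps)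
    then show ?thesis using G_I[OF \<open>b \<in> lin\<close>, of "c + c'"] by simp
  qed
  then have "(\<lambda>p \<epsilon>. p (\<phi> \<epsilon>)) ` G \<subseteq> EG" unfolding EG_def using closure_subset by blast
  then have "(\<lambda>p \<epsilon>. p (\<phi> \<epsilon>)) ` EG \<subseteq> EG"
    unfolding EG_def by (rule image_closure_subset[OF continuous_on_reindex closed_closure])
  then show ?thesis using assms by blast
qed

lemma EF_reindex:
  assumes "affine_reindex \<phi>" "\<phi> {} = {}" "p \<in> EF"
  shows "(\<lambda>\<epsilon>. p (\<phi> \<epsilon>)) \<in> EF"
proof -
  have "(\<lambda>\<epsilon>. h (\<phi> \<epsilon>)) \<in> F" if "h \<in> F" for h
  proof -
    from that obtain a where "a \<in> lin" "h = (\<lambda>\<epsilon>. T (a \<epsilon>))" unfolding F_def by blast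
    then show ?thesis using F_I[OF lin_affine_reindex0[OF assms(1,2)]] by simp
  qed
  then have "(\<lambda>p \<epsilon>. p (\<phi> \<epsilon>)) ` F \<subseteq> EF" unfolding EF_def using closure_subset by blast
  then have "(\<lambda>p \<epsilon>. p (\<phi> \<epsilon>)) ` EF \<subseteq> EF"
    unfolding EF_def by (rule image_closure_subset[OF continuous_on_reindex closed_closure])
  then show ?thesis using assms by blast
qed

text \<open>The hypothesis solves the problem for exponents; the solution passes to limits because
  the reindexed image of the compact \<open>EF\<close> is closed. The effect is to trade the free
  constant of \<open>EG\<close> for a position of the cube inside a larger one where the vertex
  \<open>{}\<close> is avoided.\<close>

lemma EG_lift_EF:
  assumes "\<And>a c. a \<in> lin \<Longrightarrow> \<exists>b\<in>lin. \<forall>\<epsilon>. b (\<psi> \<epsilon>) = c + a (\<phi> \<epsilon>)" "p \<in> EG"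
  shows "\<exists>q\<in>EF. \<forall>\<epsilon>. q (\<psi> \<epsilon>) = p (\<phi> \<epsilon>)"
proof -
  let ?\<phi> = "\<lambda>p \<epsilon>. p (\<phi> \<epsilon>)" and ?\<psi> = "\<lambda>p \<epsilon>. p (\<psi> \<epsilon>)"
  have "?\<phi> h \<in> ?\<psi> ` EF" if "h \<in> G" for h
  proof -
    from that obtain a c where a: "a \<in> lin" "h = (\<lambda>\<epsilon>. T (c + a \<epsilon>))" unfolding G_def by auto
    then obtain b where b: "b \<in> lin" "\<And>\<epsilon>. b (\<psi> \<epsilon>) = c + a (\<phi> \<epsilon>)" using assms(1) by blast
    then have "(\<lambda>\<epsilon>. T (b \<epsilon>)) \<in> EF" unfolding EF_def using closure_subset F_I by blast
    then show ?thesis using a b by (intro image_eqI[of _ _ "\<lambda>\<epsilon>. T (b \<epsilon>)"]) auto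
  qed
  then have "?\<phi> ` G \<subseteq> ?\<psi> ` EF" by blast
  moreover have "closed (?\<psi> ` EF)"
    using compact_continuous_image[OF continuous_on_reindex compact_EF] compact_imp_closed by blast
  ultimately have "?\<phi> ` EG \<subseteq> ?\<psi> ` EF"
    unfolding EG_def using image_closure_subset[OF continuous_on_reindex] by blast
  then have "?\<phi> p \<in> ?\<psi> ` EF" using assms(2) by blast
  then obtain q where q: "q \<in> EF" "?\<phi> p = ?\<psi> q" by blast
  have "\<forall>\<epsilon>. q (\<psi> \<epsilon>) = p (\<phi> \<epsilon>)" using fun_cong[OF q(2)] by simp
  then show ?thesis using q(1) by blast
qed

text \<open>The usual enveloping semigroup of (X,S), obtained as a projection of \<open>EG\<close>
  so that it inherits compactness and products; by reindexing, every vertex gives entries in the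
  same set.\<close>

definition Et :: "('a \<Rightarrow> 'a) set" where "Et = (\<lambda>p. p {}) ` EG"

lemma const_reindex: "affine_reindex (\<lambda>_. \<delta>)"
  by (auto simp: affine_reindex_def)

lemma Et_const: "q \<in> Et \<Longrightarrow> (\<lambda>_. q) \<in> EG"
proof -
  assume "q \<in> Et"
  then obtain p where "p \<in> EG" "q = p {}" unfolding Et_def by blast
  then show ?thesis using EG_reindex[OF const_reindex[of "{}"], of p] by simp
qed

lemma EG_Et: "p \<in> EG \<Longrightarrow> p \<epsilon> \<in> Et"
  using EG_reindex[OF const_reindex[of \<epsilon>], of p] 
  unfolding Et_def by (auto intro: image_eqI[rotated])

lemma compact_Et: "compact Et"
  unfolding Et_def using compact_EG continuous_on_product_then_coordinatewise[OF continuous_on_id]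
  by (rule compact_continuous_image[rotated])

lemma T_Et: "T n \<in> Et"
proof -
  have "(\<lambda>_. T n) \<in> G" using G_I[OF lin.zero, of n] by simp
  then have "(\<lambda>_. T n) \<in> EG" unfolding EG_def using closure_subset by blast
  from EG_Et[OF this] show ?thesis by simp
qed

lemma Et_comp: "p \<in> Et \<Longrightarrow> q \<in> Et \<Longrightarrow> p \<circ> q \<in> Et"
  using EG_Et[OF EG_comp[OF Et_const Et_const], of p q] by (simp add: fam_comp_def)

lemma Et_in: "p \<in> Et \<Longrightarrow> x \<in> X \<Longrightarrow> p x \<in> X"
proof -
  assume "p \<in> Et" "x \<in> X"
  then obtain r where "r \<in> EG" "p = r {}" unfolding Et_def by blast
  then show ?thesis using W_in[of r] EG_subset_W \<open>x \<in> X\<close> by blast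
qed

lemma EF_empty: "p \<in> EF \<Longrightarrow> p {} = id"
proof -
  assume "p \<in> EF"
  have "continuous_on EF (\<lambda>p. p {})"
    by (rule continuous_on_product_then_coordinatewise[OF continuous_on_id])
  then have "(\<lambda>p. p {}) ` EF \<subseteq> {id}"
    unfolding EF_def by (rule image_closure_subset) (auto simp: F_def lin_empty T_0)
  then show ?thesis using \<open>p \<in> EF\<close> by blast
qed

text \<open>A single entry suffices: take a member of \<open>EF\<close> with value \<open>q\<close>
  at \<open>{i}\<close> and pull it back along the map that remembers only coordinate
  \<open>i\<close>. The other vertices are sent to \<open>{}\<close>, where \<open>EF\<close> is the
  identity.\<close>

lemma face_EF: "q \<in> Et \<Longrightarrow> (\<lambda>\<epsilon>. if i \<in> \<epsilon> then q else id) \<in> EF"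
proof -
  assume q: "q \<in> Et"
  let ?\<psi> = "\<lambda>\<epsilon>. if i \<in> \<epsilon> then {i} else ({}::nat set)"
  have *: "\<exists>b\<in>lin. b {i} = c + a {}" for c and a :: "nat set \<Rightarrow> int"
    using lin.face[OF lin.zero, of i "c + a {}"] by (rule bexI[rotated]) simp
  have "\<exists>r\<in>EF. \<forall>\<epsilon>::nat set. r {i} = (\<lambda>_::nat set. q) {}"
    by (rule EG_lift_EF[where \<psi> = "\<lambda>_. {i}" and \<phi> = "\<lambda>_. {}"]) (simp_all add: * Et_const[OF q])
  then obtain r where r: "r \<in> EF" "r {i} = q" by blast
  have "affine_reindex ?\<psi>" unfolding affine_reindex_def
  proof
    fix k
    show "(\<exists>j. \<forall>\<epsilon>. k \<in> ?\<psi> \<epsilon> \<longleftrightarrow> j \<in> \<epsilon>) \<or> (\<forall>\<epsilon>. k \<notin> ?\<psi> \<epsilon>) \<or> (\<forall>\<epsilon>. k \<in> ?\<psi> \<epsilon>)"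
    proof (cases "k = i")
      case True
      then have "\<forall>\<epsilon>. k \<in> ?\<psi> \<epsilon> \<longleftrightarrow> i \<in> \<epsilon>" by simp
      then show ?thesis by blast
    qed simp
  qed
  then have "(\<lambda>\<epsilon>. r (?\<psi> \<epsilon>)) \<in> EF" using EF_reindex[of ?\<psi>, OF _ _ r(1)] by simp
  moreover have "(\<lambda>\<epsilon>. r (?\<psi> \<epsilon>)) = (\<lambda>\<epsilon>. if i \<in> \<epsilon> then q else id)"
    by (rule ext) (simp add: r(2) EF_empty[OF r(1)])
  ultimately show ?thesis by simp
qed

lemma Et_nonempty: "Et \<noteq> {}" using T_Et by blast

end

section \<open>The groups of cubes of a minimal idempotent\<close>

text \<open>Minimality of \<open>u\<close> is expressed by an equation about the idempotents of the
  form \<open>p \<circ> u\<close>, not by minimal left ideals: an equation can be checked vertex by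
  vertex and therefore carries over to cubes.\<close>

locale ellis = cascade +
  fixes u :: "'a \<Rightarrow> 'a"
  assumes u_Et: "u \<in> Et" and u_idem: "u \<circ> u = u"
    and u_min: "\<And>p. \<lbrakk>p \<in> Et; (p \<circ> u) \<circ> (p \<circ> u) = p \<circ> u\<rbrakk> \<Longrightarrow> u \<circ> (p \<circ> u) = u"
begin

definition Ug :: "('a \<Rightarrow> 'a) set" where
  "Ug = {p \<in> Et. u \<circ> p = p \<and> p \<circ> u = p}"

definition HK :: "(nat set \<Rightarrow> 'a \<Rightarrow> 'a) set" where
  "HK = {p \<in> EG. \<forall>\<epsilon>. p \<epsilon> \<in> Ug}"

text \<open>The vertex \<open>{}\<close> is exempt because members of \<open>EF\<close> are the
  identity there, which in general is not in \<open>Ug\<close>.\<close>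

definition HF :: "(nat set \<Rightarrow> 'a \<Rightarrow> 'a) set" where
  "HF = {p \<in> EF. \<forall>\<epsilon>. \<epsilon> \<noteq> {} \<longrightarrow> p \<epsilon> \<in> Ug}"

lemma Ug_Et: "p \<in> Ug \<Longrightarrow> p \<in> Et" and Ug_left: "p \<in> Ug \<Longrightarrow> u \<circ> p = p"
  and Ug_right: "p \<in> Ug \<Longrightarrow> p \<circ> u = p"
  by (simp_all add: Ug_def)

lemma u_Ug: "u \<in> Ug"
  by (simp add: Ug_def u_Et u_idem)

lemma Ug_comp: "p \<in> Ug \<Longrightarrow> q \<in> Ug \<Longrightarrow> p \<circ> q \<in> Ug"
  by (simp add: Ug_def Et_comp o_assoc) (simp add: o_assoc[symmetric])

lemma Ug_proj: "q \<in> Et \<Longrightarrow> u \<circ> q \<circ> u \<in> Ug"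
  unfolding Ug_def mem_Collect_eq
proof (intro conjI)
  assume q: "q \<in> Et"
  show "u \<circ> q \<circ> u \<in> Et" using q u_Et Et_comp by blast
  show "u \<circ> (u \<circ> q \<circ> u) = u \<circ> q \<circ> u" by (simp add: o_assoc u_idem)
  show "u \<circ> q \<circ> u \<circ> u = u \<circ> q \<circ> u" by (simp only: o_assoc[symmetric] u_idem)
qed

text \<open>The left ideal generated by \<open>p\<close> contains an idempotent, which \<open>w\<close> absorbs from the left
  because \<open>u\<close> is a minimal idempotent.\<close>

lemma left_inverse:
  assumes E: "E \<subseteq> EG" "compact E" "\<And>p q. p \<in> E \<Longrightarrow> q \<in> E \<Longrightarrow> p \<bullet>\<bullet> q \<in> E"
    and "w \<in> E" "p \<in> E" "p \<bullet>\<bullet> w = p"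
    and w: "\<And>\<epsilon>. w \<epsilon> = u \<or> (w \<epsilon> = id \<and> (\<forall>q\<in>E. q \<epsilon> = id))"
  shows "\<exists>q\<in>E. q \<bullet>\<bullet> p = w"
proof -
  let ?K = "(\<lambda>q. q \<bullet>\<bullet> p) ` E"
  have "compact ?K"
    using compact_continuous_image[OF continuous_on_fam_comp_left \<open>compact E\<close>] .
  then obtain v where v: "v \<in> ?K" "v \<bullet>\<bullet> v = v"
  proof (rule idempotent_exists[where f = fam_comp])
    show "?K \<noteq> {}" using \<open>p \<in> E\<close> by blast
    show "r \<bullet>\<bullet> s \<in> ?K" if rs: "r \<in> ?K" "s \<in> ?K" for r s
    proof -
      obtain a b where "a \<in> E" "r = a \<bullet>\<bullet> p" "b \<in> E" "s = b \<bullet>\<bullet> p" using rs by blast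
      then have "r \<bullet>\<bullet> s = (a \<bullet>\<bullet> p \<bullet>\<bullet> b) \<bullet>\<bullet> p" "a \<bullet>\<bullet> p \<bullet>\<bullet> b \<in> E"
        using E(3) \<open>p \<in> E\<close> by (simp_all add: fam_comp_assoc)
      then show ?thesis by blast
    qed
  qed (simp_all add: fam_comp_assoc continuous_on_fam_comp_left)
  then obtain q where q: "q \<in> E" "v = q \<bullet>\<bullet> p" by blast
  have "v \<in> E" using q E(3) \<open>p \<in> E\<close> by simp
  have "(w \<bullet>\<bullet> v) \<epsilon> = w \<epsilon>" for \<epsilon>
  proof (cases "w \<epsilon> = u")
    case True
    \<comment> \<open>This gives the entry of \<open>v\<close> the shape \<open>p \<circ> u\<close>
      required by \<open>u_min\<close>.\<close>
    have "v \<bullet>\<bullet> w = v" using q(2) \<open>p \<bullet>\<bullet> w = p\<close> by (simp add: fam_comp_assoc)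
    then have "v \<epsilon> \<circ> u = v \<epsilon>" using fun_cong[of _ _ \<epsilon>] True by (fastforce simp: fam_comp_def)
    moreover have "v \<epsilon> \<circ> v \<epsilon> = v \<epsilon>" using fun_cong[OF v(2), of \<epsilon>] by (simp add: fam_comp_def)
    moreover have "v \<epsilon> \<in> Et" using \<open>v \<in> E\<close> E(1) EG_Et by blast
    ultimately have "u \<circ> v \<epsilon> = u" using u_min[of "v \<epsilon>"] by simp
    then show ?thesis using True by (simp add: fam_comp_def)
  next
    case False
    then have "w \<epsilon> = id" "v \<epsilon> = id" using w[of \<epsilon>] \<open>v \<in> E\<close> by auto
    then show ?thesis by (simp add: fam_comp_def)
  qed
  then have "w \<bullet>\<bullet> v = w" by (rule ext)
  then have "(w \<bullet>\<bullet> q) \<bullet>\<bullet> p = w" using q(2) by (simp add: fam_comp_assoc)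
  then show ?thesis using E(3)[OF \<open>w \<in> E\<close> q(1)] by blast
qed

section \<open>The group of cubes with entries in \<open>Ug\<close>\<close>

lemma HK_EG: "p \<in> HK \<Longrightarrow> p \<in> EG" and HK_Ug: "p \<in> HK \<Longrightarrow> p \<epsilon> \<in> Ug"
  by (simp_all add: HK_def)

lemma HK_const: "q \<in> Ug \<Longrightarrow> (\<lambda>_. q) \<in> HK"
  by (simp add: HK_def Et_const Ug_Et)

lemma HK_comp: "p \<in> HK \<Longrightarrow> q \<in> HK \<Longrightarrow> (\<lambda>\<epsilon>. p \<epsilon> \<circ> q \<epsilon>) \<in> HK"
  using EG_comp[of p q] by (simp add: HK_def Ug_comp fam_comp_def)

lemma HK_reindex: "affine_reindex \<phi> \<Longrightarrow> p \<in> HK \<Longrightarrow> (\<lambda>\<epsilon>. p (\<phi> \<epsilon>)) \<in> HK"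
  using EG_reindex[of \<phi> p] by (simp add: HK_def)

lemma HK_proj: "q \<in> EG \<Longrightarrow> (\<lambda>\<epsilon>. u \<circ> q \<epsilon> \<circ> u) \<in> HK"
  using EG_comp[OF EG_comp[OF Et_const[OF u_Et]] Et_const[OF u_Et], of q]
  by (simp add: HK_def Ug_proj EG_Et fam_comp_def)

lemma HK_left_inverse:
  assumes "p \<in> HK"
  shows "\<exists>q\<in>HK. \<forall>\<epsilon>. q \<epsilon> \<circ> p \<epsilon> = u"
proof -
  have "p \<bullet>\<bullet> (\<lambda>_. u) = p" by (simp add: fam_comp_def Ug_right[OF HK_Ug[OF assms]])
  then obtain q where q: "q \<in> EG" "q \<bullet>\<bullet> p = (\<lambda>_. u)"
    using left_inverse[OF order_refl compact_EG EG_comp Et_const[OF u_Et] HK_EG[OF assms]] by blast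
  have "u \<circ> q \<epsilon> \<circ> u \<circ> p \<epsilon> = u" for \<epsilon>
  proof -
    have "q \<epsilon> \<circ> p \<epsilon> = u" using fun_cong[OF q(2), of \<epsilon>] by (simp add: fam_comp_def)
    then show ?thesis using Ug_left[OF HK_Ug[OF assms], of \<epsilon>] u_idem by (metis comp_assoc)
  qed
  then show ?thesis by (intro bexI[OF _ HK_proj[OF q(1)]]) simp
qed

definition ginv :: "('a \<Rightarrow> 'a) \<Rightarrow> 'a \<Rightarrow> 'a" where
  "ginv p = (SOME q. q \<in> Ug \<and> q \<circ> p = u)"

lemma ginv:
  assumes "p \<in> Ug"
  shows ginv_Ug: "ginv p \<in> Ug" and ginv_left: "ginv p \<circ> p = u"
proof -
  obtain q where "q \<in> HK" "q {} \<circ> p = u"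
    using HK_left_inverse[OF HK_const[OF assms]] by blast
  then have "q {} \<in> Ug \<and> q {} \<circ> p = u" using HK_Ug by blast
  then have "ginv p \<in> Ug \<and> ginv p \<circ> p = u" unfolding ginv_def
    by (rule someI[where P = "\<lambda>q. q \<in> Ug \<and> q \<circ> p = u"])
  then show "ginv p \<in> Ug" "ginv p \<circ> p = u" by auto
qed

lemma ginv_right:
  assumes "p \<in> Ug"
  shows "p \<circ> ginv p = u"
proof -
  let ?q = "ginv p"
  let ?r = "ginv ?q"
  have q: "?q \<in> Ug" "?q \<circ> p = u" using ginv[OF assms] by auto
  have r: "?r \<in> Ug" "?r \<circ> ?q = u" using ginv[OF q(1)] by auto
  have "p = ?r \<circ> ?q \<circ> p" using r(2) Ug_left[OF assms] by simp
  also have "\<dots> = ?r" using q(2) Ug_right[OF r(1)] by (simp only: comp_assoc)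
  finally show ?thesis using r(2) by simp
qed

lemma ginv_unique:
  assumes "p \<in> Ug" "q \<in> Ug" "q \<circ> p = u"
  shows "q = ginv p"
proof -
  have "q = q \<circ> (p \<circ> ginv p)" using ginv_right[OF assms(1)] Ug_right[OF assms(2)] by simp
  also have "\<dots> = ginv p" using assms(3) Ug_left[OF ginv_Ug[OF assms(1)]] by (simp add: o_assoc)
  finally show ?thesis .
qed

lemma ginv_u: "ginv u = u"
  using ginv_unique[OF u_Ug u_Ug u_idem] by simp

text \<open>A left inverse exists within \<open>HK\<close>; since inverses in \<open>Ug\<close> are
  unique, it must be the entrywise one.\<close>

lemma HK_inv: "p \<in> HK \<Longrightarrow> (\<lambda>\<epsilon>. ginv (p \<epsilon>)) \<in> HK"
proof -
  assume p: "p \<in> HK"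
  then obtain q where q: "q \<in> HK" "\<And>\<epsilon>. q \<epsilon> \<circ> p \<epsilon> = u" using HK_left_inverse by blast
  have "(\<lambda>\<epsilon>. ginv (p \<epsilon>)) = q"
    using ginv_unique[OF HK_Ug[OF p] HK_Ug[OF q(1)] q(2)] by auto
  then show ?thesis using q(1) by simp
qed

section \<open>The corresponding group for the face group\<close>

definition wF :: "nat set \<Rightarrow> 'a \<Rightarrow> 'a" where
  "wF = (\<lambda>\<epsilon>. if \<epsilon> = {} then id else u)"

text \<open>The product of the faces with value \<open>u\<close> in the first \<open>N\<close>
  directions is \<open>u\<close> exactly at the vertices meeting these directions, as repeated
  factors collapse by idempotence. With infinitely many directions \<open>wF\<close> is only the
  limit of these products; at each vertex they are eventually constant.\<close>

lemma wF_EF: "wF \<in> EF"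
proof -
  define w where "w N = (\<lambda>\<epsilon>. if \<epsilon> \<inter> {..<N} = {} then id else u)" for N :: nat
  have "w N \<in> EF" for N
  proof (induction N)
    case 0
    have "(\<lambda>_. T 0) \<in> F" using F_I[OF lin.zero] .
    moreover have "w 0 = (\<lambda>_. T 0)" by (simp add: w_def T_0)
    ultimately show ?case unfolding EF_def using closure_subset by auto
  next
    case (Suc N)
    have "w (Suc N) = w N \<bullet>\<bullet> (\<lambda>\<epsilon>. if N \<in> \<epsilon> then u else id)"
    proof
      fix \<epsilon>
      have "\<epsilon> \<inter> {..<Suc N} = {} \<longleftrightarrow> \<epsilon> \<inter> {..<N} = {} \<and> N \<notin> \<epsilon>"
        by (auto simp: lessThan_Suc)
      then show "w (Suc N) \<epsilon> = (w N \<bullet>\<bullet> (\<lambda>\<epsilon>. if N \<in> \<epsilon> then u else id)) \<epsilon>"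
        by (simp add: w_def fam_comp_def u_idem)
    qed
    then show ?case using EF_comp[OF Suc face_EF[OF u_Et]] by simp
  qed
  moreover have "w \<longlonglongrightarrow> wF"
  proof -
    have "(\<lambda>N. w N \<epsilon>) \<longlonglongrightarrow> wF \<epsilon>" for \<epsilon>
    proof (rule tendsto_eventually)
      show "\<forall>\<^sub>F N in sequentially. w N \<epsilon> = wF \<epsilon>"
      proof (cases "\<epsilon> = {}")
        case False
        then obtain i where "i \<in> \<epsilon>" by blast
        then have "w N \<epsilon> = wF \<epsilon>" if "N \<ge> Suc i" for N using that by (auto simp: w_def wF_def)
        then show ?thesis unfolding eventually_sequentially by blast
      qed (simp add: w_def wF_def)
    qed
    then have "limitin (product_topology (\<lambda>_. euclidean) UNIV) w wF sequentially"
      by (simp add: limitin_componentwise)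
    then show ?thesis unfolding euclidean_product_topology by simp
  qed
  ultimately show ?thesis
    unfolding EF_def using Lim_in_closed_set[OF closed_closure, of w F sequentially wF] by simp
qed

lemma HF_EF: "p \<in> HF \<Longrightarrow> p \<in> EF" and HF_Ug: "p \<in> HF \<Longrightarrow> \<epsilon> \<noteq> {} \<Longrightarrow> p \<epsilon> \<in> Ug"
  by (simp_all add: HF_def)

lemma HF_comp: "p \<in> HF \<Longrightarrow> q \<in> HF \<Longrightarrow> (\<lambda>\<epsilon>. p \<epsilon> \<circ> q \<epsilon>) \<in> HF"
  using EF_comp[of p q] by (simp add: HF_def Ug_comp fam_comp_def)

lemma EF_Et: "p \<in> EF \<Longrightarrow> p \<epsilon> \<in> Et"
  using EF_subset_EG EG_Et by blast

lemma HF_proj: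
  assumes "q \<in> EF"
  shows "(\<lambda>\<epsilon>. if \<epsilon> = {} then id else u \<circ> q \<epsilon> \<circ> u) \<in> HF"
proof -
  have "wF \<bullet>\<bullet> q \<bullet>\<bullet> wF = (\<lambda>\<epsilon>. if \<epsilon> = {} then id else u \<circ> q \<epsilon> \<circ> u)"
    by (rule ext) (simp add: fam_comp_def wF_def EF_empty[OF assms])
  moreover have "wF \<bullet>\<bullet> q \<bullet>\<bullet> wF \<in> EF" using EF_comp wF_EF assms by blast
  ultimately show ?thesis by (simp add: HF_def Ug_proj EF_Et[OF assms])
qed

text \<open>Here \<open>wF\<close> replaces the constant family \<open>u\<close> as the identity;
  the second alternative for \<open>w\<close> in \<open>left_inverse\<close> accounts for the vertex
  \<open>{}\<close>.\<close>

lemma HF_inv: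
  assumes "p \<in> HF"
  shows "(\<lambda>\<epsilon>. if \<epsilon> = {} then id else ginv (p \<epsilon>)) \<in> HF"
proof -
  have "(p \<bullet>\<bullet> wF) \<epsilon> = p \<epsilon>" for \<epsilon>
    using Ug_right[OF HF_Ug[OF assms, of \<epsilon>]] by (cases "\<epsilon> = {}") (simp_all add: fam_comp_def wF_def)
  then have "p \<bullet>\<bullet> wF = p" by (rule ext)
  moreover have "wF \<epsilon> = u \<or> (wF \<epsilon> = id \<and> (\<forall>q\<in>EF. q \<epsilon> = id))" for \<epsilon>
  proof (cases "\<epsilon> = {}")
    case True
    then have "wF \<epsilon> = id" by (simp add: wF_def)
    then show ?thesis using EF_empty True by blast
  qed (simp add: wF_def)
  ultimately obtain q where q: "q \<in> EF" "q \<bullet>\<bullet> p = wF"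
    using left_inverse[OF EF_subset_EG compact_EF EF_comp wF_EF HF_EF[OF assms]] by blast
  have "u \<circ> q \<epsilon> \<circ> u = ginv (p \<epsilon>)" if "\<epsilon> \<noteq> {}" for \<epsilon>
  proof (rule ginv_unique[OF HF_Ug[OF assms that] Ug_proj[OF EF_Et[OF q(1)]]])
    have "q \<epsilon> \<circ> p \<epsilon> = u" using fun_cong[OF q(2), of \<epsilon>] that by (simp add: fam_comp_def wF_def)
    then show "u \<circ> q \<epsilon> \<circ> u \<circ> p \<epsilon> = u"
      using Ug_left[OF HF_Ug[OF assms that]] u_idem by (metis comp_assoc)
  qed
  then have "(\<lambda>\<epsilon>. if \<epsilon> = {} then id else ginv (p \<epsilon>)) = (\<lambda>\<epsilon>. if \<epsilon> = {} then id else u \<circ> q \<epsilon> \<circ> u)"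
    by auto
  then show ?thesis using HF_proj[OF q(1)] by simp
qed

text \<open>An element of \<open>HK\<close> supported on the facet \<open>{\<epsilon>. n \<in> \<epsilon>}\<close> lies in \<open>HF\<close> off \<open>{}\<close>: the spare
  direction \<open>m\<close> provides elements of \<open>HF\<close> of the form \<open>(p, u)\<close> and \<open>(p, g)\<close> with the same lower
  half \<open>p\<close>.\<close>

lemma HF_facet:
  assumes g: "g \<in> HK" "\<And>\<epsilon>. n \<notin> \<epsilon> \<Longrightarrow> g \<epsilon> = u" "\<And>\<epsilon>. g (\<epsilon> - {m}) = g \<epsilon>" and "m \<noteq> n"
  shows "(\<lambda>\<epsilon>. if \<epsilon> = {} then id else g \<epsilon>) \<in> HF"
proof -
  \<comment> \<open>Each \<open>\<psi> \<epsilon>\<close> contains exactly one of \<open>n\<close>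
    and \<open>m\<close>: the half with \<open>n\<close> stays in place, the other half moves to the
    side of \<open>m\<close>, and \<open>{}\<close> is avoided.\<close>
  define \<psi> where "\<psi> \<epsilon> = (if n \<in> \<epsilon> then \<epsilon> - {m} else insert m \<epsilon>)" for \<epsilon> :: "nat set"
  have "\<exists>b\<in>lin. \<forall>\<epsilon>. b (\<psi> \<epsilon>) = c + a (\<epsilon> - {m})" if "a \<in> lin" for a c
    using that
  proof (induction a rule: lin.induct)
    case zero
    \<comment> \<open>Exactly one of the two faces is active at \<open>\<psi> \<epsilon>\<close>, so
      together they contribute the constant \<open>c\<close>.\<close>
    let ?b = "\<lambda>\<epsilon>. 0 + (if n \<in> \<epsilon> then c else 0) + (if m \<in> \<epsilon> then c else 0)"
    have "?b \<in> lin" by (intro lin.face lin.zero)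
    moreover have "?b (\<psi> \<epsilon>) = c + 0" for \<epsilon> using \<open>m \<noteq> n\<close> by (simp add: \<psi>_def)
    ultimately show ?case by (intro bexI[of _ ?b]) auto
  next
    case (face a i k)
    then obtain b where b: "b \<in> lin" "\<And>\<epsilon>. b (\<psi> \<epsilon>) = c + a (\<epsilon> - {m})" by blast
    show ?case
    proof (cases "i = m")
      case True
      then show ?thesis using b by (intro bexI[OF _ b(1)]) simp
    next
      case False
      then have "i \<in> \<psi> \<epsilon> \<longleftrightarrow> i \<in> \<epsilon>" for \<epsilon> by (simp add: \<psi>_def)
      then show ?thesis using b False by (intro bexI[OF _ lin.face[OF b(1), of i k]]) simp
    qed
  qed
  then obtain q where q: "q \<in> EF" "\<And>\<epsilon>. q (\<psi> \<epsilon>) = g \<epsilon>"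
    using EG_lift_EF[of \<psi> "\<lambda>\<epsilon>. \<epsilon> - {m}" g] HK_EG[OF g(1)] g(3) by auto
  let ?\<phi>1 = "\<lambda>\<epsilon>. if n \<in> \<epsilon> then insert m (\<epsilon> - {n}) else \<epsilon> - {m}" and ?\<phi>2 = "\<lambda>\<epsilon>. \<epsilon> - {m}"
  \<comment> \<open>If \<open>n \<in> \<epsilon>\<close>, the first reindexing reads
    \<open>q\<close> at \<open>\<psi> (\<epsilon> - {n})\<close>, where its value is
    \<open>u\<close>, and the second at \<open>\<psi> \<epsilon>\<close>, where it is
    \<open>g \<epsilon>\<close>. If \<open>n \<notin> \<epsilon>\<close>, both read the same entry,
    about which nothing is known, and it cancels in the quotient.\<close>
  define P1 where "P1 \<epsilon> = (if \<epsilon> = {} then id else u \<circ> q (?\<phi>1 \<epsilon>) \<circ> u)" for \<epsilon>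
  define P2 where "P2 \<epsilon> = (if \<epsilon> = {} then id else u \<circ> q (?\<phi>2 \<epsilon>) \<circ> u)" for \<epsilon>
  have "P1 \<in> HF"
    using HF_proj[OF EF_reindex[OF affine_reindex_move _ q(1), of n m]] unfolding P1_def by simp
  have "P2 \<in> HF"
    using HF_proj[OF EF_reindex[OF affine_reindex_Diff _ q(1), of "{m}"]] unfolding P2_def by simp
  have ugu: "u \<circ> g \<epsilon> \<circ> u = g \<epsilon>" for \<epsilon>
    using Ug_left[OF HK_Ug[OF g(1)]] Ug_right[OF HK_Ug[OF g(1)]] by simp
  have "(if \<epsilon> = {} then id else ginv (P1 \<epsilon>)) \<circ> P2 \<epsilon> = (if \<epsilon> = {} then id else g \<epsilon>)" for \<epsilon>
  proof (cases "\<epsilon> = {}")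
    case True
    then show ?thesis by (simp add: P2_def)
  next
    case False
    have "ginv (P1 \<epsilon>) \<circ> P2 \<epsilon> = g \<epsilon>"
    proof (cases "n \<in> \<epsilon>")
      case True
      have "?\<phi>1 \<epsilon> = \<psi> (\<epsilon> - {n})" "?\<phi>2 \<epsilon> = \<psi> \<epsilon>" using True by (auto simp: \<psi>_def)
      then have "P1 \<epsilon> = u" "P2 \<epsilon> = g \<epsilon>"
        using False q(2) g(2)[of "\<epsilon> - {n}"] ugu u_idem by (auto simp: P1_def P2_def)
      then show ?thesis using Ug_left[OF HK_Ug[OF g(1)]] by (simp add: ginv_u)
    next
      case n: False
      then have "P1 \<epsilon> = P2 \<epsilon>" by (simp add: P1_def P2_def)
      then show ?thesis using ginv_left[OF HF_Ug[OF \<open>P2 \<in> HF\<close> False]] g(2)[OF n] by simp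
    qed
    then show ?thesis using False by simp
  qed
  then show ?thesis using HF_comp[OF HF_inv[OF \<open>P1 \<in> HF\<close>] \<open>P2 \<in> HF\<close>] by simp
qed

text \<open>This amounts to the uniqueness of the minimal subset for the face group among the cubes with a
  given vertex at \<open>{}\<close>.\<close>

lemma HK_imp_HF:
  assumes "g \<in> HK" "\<And>\<epsilon>. g (\<epsilon> \<inter> {..<n}) = g \<epsilon>" "g {} = u"
  shows "(\<lambda>\<epsilon>. if \<epsilon> = {} then id else g \<epsilon>) \<in> HF"
  using assms
proof (induction n arbitrary: g)
  case 0
  then have "g \<epsilon> = u" for \<epsilon> using "0.prems"(2)[of \<epsilon>] by simp
  then have "(\<lambda>\<epsilon>. if \<epsilon> = {} then id else g \<epsilon>) = wF" unfolding wF_def by presburger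
  moreover have "wF \<in> HF" using wF_EF u_Ug by (simp add: HF_def wF_def)
  ultimately show ?case by simp
next
  case (Suc n)
  \<comment> \<open>The lower facet of \<open>g\<close> in direction \<open>n\<close>, copied onto
    the upper one. It falls under the induction hypothesis, and dividing \<open>g\<close> by it
    leaves a family that is \<open>u\<close> wherever \<open>n \<notin> \<epsilon>\<close>.\<close>
  define A where "A \<epsilon> = g (\<epsilon> - {n})" for \<epsilon>
  have A: "A \<in> HK" using HK_reindex[OF affine_reindex_Diff Suc.prems(1)] by (simp add: A_def[abs_def])
  have "A (\<epsilon> \<inter> {..<n}) = A \<epsilon>" for \<epsilon>
  proof -
    have "(\<epsilon> \<inter> {..<n}) - {n} = (\<epsilon> - {n}) \<inter> {..<Suc n}" by auto
    then show ?thesis using Suc.prems(2)[of "\<epsilon> - {n}"] by (simp add: A_def)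
  qed
  moreover have "A {} = u" by (simp add: A_def Suc.prems(3))
  ultimately have AF: "(\<lambda>\<epsilon>. if \<epsilon> = {} then id else A \<epsilon>) \<in> HF" using Suc.IH[OF A] by blast
  define B where "B \<epsilon> = g \<epsilon> \<circ> ginv (A \<epsilon>)" for \<epsilon>
  have B: "B \<in> HK" using HK_comp[OF Suc.prems(1) HK_inv[OF A]] by (simp add: B_def[abs_def])
  have "B \<epsilon> = u" if "n \<notin> \<epsilon>" for \<epsilon>
    using that ginv_right[OF HK_Ug[OF Suc.prems(1)]] by (simp add: B_def A_def)
  \<comment> \<open>\<open>g\<close> sees only directions up to \<open>n\<close>, so
    \<open>Suc n\<close> can serve as the spare direction.\<close>
  moreover have "B (\<epsilon> - {Suc n}) = B \<epsilon>" for \<epsilon>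
  proof -
    have g: "g (\<delta> - {Suc n}) = g \<delta>" for \<delta>
    proof -
      have "(\<delta> - {Suc n}) \<inter> {..<Suc n} = \<delta> \<inter> {..<Suc n}" by auto
      then show ?thesis using Suc.prems(2)[of \<delta>] Suc.prems(2)[of "\<delta> - {Suc n}"] by simp
    qed
    have "\<epsilon> - {Suc n} - {n} = \<epsilon> - {n} - {Suc n}" by auto
    then show ?thesis by (simp add: B_def A_def g)
  qed
  ultimately have BF: "(\<lambda>\<epsilon>. if \<epsilon> = {} then id else B \<epsilon>) \<in> HF"
    using HF_facet[OF B, of n "Suc n"] by simp
  have "(if \<epsilon> = {} then id else B \<epsilon>) \<circ> (if \<epsilon> = {} then id else A \<epsilon>) = (if \<epsilon> = {} then id else g \<epsilon>)" for \<epsilon>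
  proof (cases "\<epsilon> = {}")
    case False
    have "B \<epsilon> \<circ> A \<epsilon> = g \<epsilon>"
      using ginv_left[OF HK_Ug[OF A]] Ug_right[OF HK_Ug[OF Suc.prems(1)]] by (simp add: B_def comp_assoc)
    then show ?thesis using False by simp
  qed simp
  then show ?case using HF_comp[OF BF AF] by simp
qed

end

section \<open>Regional proximality\<close>

lemma empty_in_cube: "{} \<in> cube d"
  by (simp add: cube_def)

lemma finite_cube: "finite (cube d)"
  by (simp add: cube_def)

lemma face_group_imp_lin:
  assumes "f \<in> face_group integer_group d"
  shows "\<exists>a\<in>lin. \<forall>\<epsilon>\<in>cube d. f \<epsilon> = a \<epsilon>"
proof -
  let ?gen = "{face_elt integer_group d t (upper_facet d i) |t i. t \<in> carrier integer_group \<and> i \<in> {1..d}}"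
  have gen: "\<exists>t i. h = (\<lambda>\<epsilon>\<in>cube d. if i \<in> \<epsilon> then t else 0)" if "h \<in> ?gen" for h
  proof -
    from that obtain t i where "h = face_elt integer_group d t (upper_facet d i)" by blast
    then have "h = (\<lambda>\<epsilon>\<in>cube d. if i \<in> \<epsilon> then t else 0)"
      by (auto simp: face_elt_def upper_facet_def)
    then show ?thesis by blast
  qed
  have "f \<in> generate (cube_group integer_group d) ?gen"
    using assms by (simp add: face_group_def)
  then show ?thesis
  proof (induction f rule: generate.induct)
    case one
    show ?case by (intro bexI[OF _ lin.zero]) (simp add: cube_group_def)
  next
    case (incl h)
    then obtain t i where "h = (\<lambda>\<epsilon>\<in>cube d. if i \<in> \<epsilon> then t else 0)" using gen by blast
    then show ?case by (intro bexI[OF _ lin.face[OF lin.zero, of i t]]) simp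
  next
    case (inv h)
    then obtain t i where h: "h = (\<lambda>\<epsilon>\<in>cube d. if i \<in> \<epsilon> then t else 0)" using gen by blast
    have minus: "inv\<^bsub>integer_group\<^esub> k = - k" for k
      by (rule group.inv_equality) auto
    have "inv\<^bsub>cube_group integer_group d\<^esub> h = (\<lambda>\<epsilon>\<in>cube d. - h \<epsilon>)"
      unfolding cube_group_def by (subst inv_product_group) (auto simp: h minus)
    then show ?case using h by (intro bexI[OF _ lin.face[OF lin.zero, of i "- t"]]) simp
  next
    case (eng h1 h2)
    then obtain a b where "a \<in> lin" "b \<in> lin" "\<forall>\<epsilon>\<in>cube d. h1 \<epsilon> = a \<epsilon>" "\<forall>\<epsilon>\<in>cube d. h2 \<epsilon> = b \<epsilon>"
      by blast
    then show ?case
      by (intro bexI[OF _ lin_add[of b a]]) (simp_all add: cube_group_def)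
  qed
qed

text \<open>Faces in directions outside \<open>{1..d}\<close> act trivially on
  \<open>cube d\<close>, so restriction simply drops them.\<close>

lemma lin_imp_face_group:
  assumes "a \<in> lin"
  shows "restrict a (cube d) \<in> face_group integer_group d"
  using assms
proof (induction a rule: lin.induct)
  case zero
  have "restrict (\<lambda>_. 0) (cube d) = \<one>\<^bsub>cube_group integer_group d\<^esub>"
    by (simp add: cube_group_def)
  then show ?case unfolding face_group_def using generate.one by metis
next
  case (face a i k)
  show ?case
  proof (cases "i \<in> {1..d}")
    case True
    let ?h = "face_elt integer_group d k (upper_facet d i)"
    have "restrict (\<lambda>\<epsilon>. a \<epsilon> + (if i \<in> \<epsilon> then k else 0)) (cube d)
        = restrict a (cube d) \<otimes>\<^bsub>cube_group integer_group d\<^esub> ?h"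
      by (auto simp: cube_group_def face_elt_def upper_facet_def)
    moreover have "?h \<in> face_group integer_group d"
      unfolding face_group_def using True by (intro generate.incl) auto
    ultimately show ?thesis using face.IH unfolding face_group_def by (simp only: generate.eng)
  next
    case False
    then have "restrict (\<lambda>\<epsilon>. a \<epsilon> + (if i \<in> \<epsilon> then k else 0)) (cube d) = restrict a (cube d)"
      by (intro restrict_ext) (auto simp: cube_def)
    then show ?thesis using face.IH by simp
  qed
qed

context cascade
begin

lemma limitin_cube_act:
  assumes "\<forall>\<^sub>F t in \<F>. w t \<in> X" "l \<in> cube d \<rightarrow>\<^sub>E X"
  shows "limitin (cube_topology X d) (\<lambda>t. cube_act X S d (f t) (cube_diag d (w t))) l \<F> \<longleftrightarrow>
    (\<forall>\<epsilon>\<in>cube d. ((\<lambda>t. zact X S (f t \<epsilon>) (w t)) \<longlongrightarrow> l \<epsilon>) \<F>)"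
proof -
  have "\<forall>\<^sub>F t in \<F>. cube_act X S d (f t) (cube_diag d (w t)) \<in> cube d \<rightarrow>\<^sub>E X"
    using assms(1)
    by (rule eventually_mono) (auto simp: cube_act_def cube_diag_def zact_in)
  moreover have "\<forall>\<^sub>F t in \<F>. zact X S (f t \<epsilon>) (w t) \<in> X" for \<epsilon>
    using assms(1) by (rule eventually_mono) (rule zact_in)
  moreover have "cube_act X S d (f t) (cube_diag d (w t)) \<epsilon> = zact X S (f t \<epsilon>) (w t)"
    if "\<epsilon> \<in> cube d" for \<epsilon> t
    using that by (simp add: cube_act_def cube_diag_def)
  ultimately show ?thesis
    using assms(2)
    by (auto simp: cube_topology_def limitin_componentwise limitin_subtopology PiE_iff)
qed

lemma RP_iff:
  "(x, y) \<in> RP X S d \<longleftrightarrow> x \<in> X \<and> y \<in> X \<and> (\<exists>\<F>. \<exists>a \<in> (cube d - {{}}) \<rightarrow>\<^sub>E X. \<F> \<noteq> bot \<and>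
     (\<forall>\<^sub>F t in \<F>. fst t \<in> face_group integer_group d \<and> fst (snd t) \<in> X \<and> snd (snd t) \<in> X) \<and>
     (\<forall>\<epsilon>\<in>cube d. ((\<lambda>t. zact X S (fst t \<epsilon>) (fst (snd t))) \<longlongrightarrow> (a({} := x)) \<epsilon>) \<F>) \<and>
     (\<forall>\<epsilon>\<in>cube d. ((\<lambda>t. zact X S (fst t \<epsilon>) (snd (snd t))) \<longlongrightarrow> (a({} := y)) \<epsilon>) \<F>))"
proof -
  have lim: "limitin (prod_topology (cube_topology X d) (cube_topology X d))
        (\<lambda>(f, u, v). (cube_act X S d f (cube_diag d u), cube_act X S d f (cube_diag d v)))
        (a({} := x), a({} := y)) \<F> \<longleftrightarrow>
      (\<forall>\<epsilon>\<in>cube d. ((\<lambda>t. zact X S (fst t \<epsilon>) (fst (snd t))) \<longlongrightarrow> (a({} := x)) \<epsilon>) \<F>) \<and>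
      (\<forall>\<epsilon>\<in>cube d. ((\<lambda>t. zact X S (fst t \<epsilon>) (snd (snd t))) \<longlongrightarrow> (a({} := y)) \<epsilon>) \<F>)"
    if a: "a \<in> (cube d - {{}}) \<rightarrow>\<^sub>E X" and xy: "x \<in> X" "y \<in> X"
      and ev: "\<forall>\<^sub>F t in \<F>. fst t \<in> face_group integer_group d \<and> fst (snd t) \<in> X \<and> snd (snd t) \<in> X"
    for a and \<F> :: "((nat set \<Rightarrow> int) \<times> 'a \<times> 'a) filter"
  proof -
    have upd: "a({} := z) \<in> cube d \<rightarrow>\<^sub>E X" if "z \<in> X" for z
      using a that empty_in_cube[of d] by (auto simp: PiE_iff extensional_def)
    have ev': "\<forall>\<^sub>F t in \<F>. fst (snd t) \<in> X" "\<forall>\<^sub>F t in \<F>. snd (snd t) \<in> X"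
      using ev by (auto elim: eventually_mono)
    have comp: "fst \<circ> (\<lambda>(f, u, v). (cube_act X S d f (cube_diag d u), cube_act X S d f (cube_diag d v)))
        = (\<lambda>t. cube_act X S d (fst t) (cube_diag d (fst (snd t))))"
      "snd \<circ> (\<lambda>(f, u, v). (cube_act X S d f (cube_diag d u), cube_act X S d f (cube_diag d v)))
        = (\<lambda>t. cube_act X S d (fst t) (cube_diag d (snd (snd t))))"
      by (simp_all add: fun_eq_iff split_beta)
    show ?thesis
      unfolding limitin_pairwise comp fst_conv snd_conv
        limitin_cube_act[OF ev'(1) upd[OF xy(1)]] limitin_cube_act[OF ev'(2) upd[OF xy(2)]] ..
  qed
  show ?thesis
    unfolding RP_def mem_Collect_eq prod.case split_beta'
    by (intro conj_cong ex_cong1 bex_cong refl) (simp_all add: lim[unfolded split_beta'])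
qed

text \<open>Only finitely many vertices matter, so the net reduces to one triple for each \<delta>,
  and the common limit tuple disappears through the triangle inequality. Independence of direction
  \<open>0\<close> leaves that direction free to separate the two points.\<close>

lemma RP_approx:
  assumes "(x, y) \<in> RP X S d" "\<delta> > 0"
  obtains a u v where "a \<in> lin" "\<And>\<epsilon>. a (\<epsilon> - {0}) = a \<epsilon>" "u \<in> X" "v \<in> X"
    "dist u x < \<delta>" "dist v y < \<delta>"
    "\<And>\<epsilon>. \<epsilon> \<in> cube d - {{}} \<Longrightarrow> dist (zact X S (a \<epsilon>) u) (zact X S (a \<epsilon>) v) < \<delta>"
proof -
  obtain \<F> b where \<F>: "\<F> \<noteq> bot"
    and ev: "\<forall>\<^sub>F t in \<F>. fst t \<in> face_group integer_group d \<and> fst (snd t) \<in> X \<and> snd (snd t) \<in> X"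
    and lim: "\<And>\<epsilon>. \<epsilon> \<in> cube d \<Longrightarrow> ((\<lambda>t. zact X S (fst t \<epsilon>) (fst (snd t))) \<longlongrightarrow> (b({} := x)) \<epsilon>) \<F>"
      "\<And>\<epsilon>. \<epsilon> \<in> cube d \<Longrightarrow> ((\<lambda>t. zact X S (fst t \<epsilon>) (snd (snd t))) \<longlongrightarrow> (b({} := y)) \<epsilon>) \<F>"
    using assms(1) unfolding RP_iff by blast
  have "\<forall>\<^sub>F t in \<F>. \<forall>\<epsilon>\<in>cube d. dist (zact X S (fst t \<epsilon>) (fst (snd t))) ((b({} := x)) \<epsilon>) < \<delta> / 2 \<and>
      dist (zact X S (fst t \<epsilon>) (snd (snd t))) ((b({} := y)) \<epsilon>) < \<delta> / 2"
    using assms(2)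
    by (intro eventually_ball_finite finite_cube ballI eventually_conj tendstoD lim) auto
  then have "\<forall>\<^sub>F t in \<F>. (fst t \<in> face_group integer_group d \<and> fst (snd t) \<in> X \<and> snd (snd t) \<in> X) \<and>
      (\<forall>\<epsilon>\<in>cube d. dist (zact X S (fst t \<epsilon>) (fst (snd t))) ((b({} := x)) \<epsilon>) < \<delta> / 2 \<and>
      dist (zact X S (fst t \<epsilon>) (snd (snd t))) ((b({} := y)) \<epsilon>) < \<delta> / 2)"
    using ev by (rule eventually_conj[rotated])
  then obtain f u v where f: "f \<in> face_group integer_group d" and uv: "u \<in> X" "v \<in> X"
    and near: "\<And>\<epsilon>. \<epsilon> \<in> cube d \<Longrightarrow> dist (zact X S (f \<epsilon>) u) ((b({} := x)) \<epsilon>) < \<delta> / 2"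
      "\<And>\<epsilon>. \<epsilon> \<in> cube d \<Longrightarrow> dist (zact X S (f \<epsilon>) v) ((b({} := y)) \<epsilon>) < \<delta> / 2"
    using eventually_happens'[OF \<F>] by (metis (no_types, lifting) prod.collapse)
  obtain a where a: "a \<in> lin" "\<And>\<epsilon>. \<epsilon> \<in> cube d \<Longrightarrow> f \<epsilon> = a \<epsilon>"
    using face_group_imp_lin[OF f] by blast
  let ?a = "\<lambda>\<epsilon>. a (\<epsilon> - {0})"
  have "\<epsilon> - {0} = \<epsilon>" if "\<epsilon> \<in> cube d" for \<epsilon> using that by (auto simp: cube_def)
  then have fa: "f \<epsilon> = ?a \<epsilon>" if "\<epsilon> \<in> cube d" for \<epsilon> using a(2) that by simp
  have z0: "zact X S 0 = id" using zact_int[of 0] by simp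
  show ?thesis
  proof (rule that)
    show "?a \<in> lin"
      using lin_affine_reindex0[OF affine_reindex_Int[of "- {0}"] _ a(1)] by (simp add: Diff_eq)
    show "u \<in> X" "v \<in> X" by (rule uv)+
    show "a (\<epsilon> - {0} - {0}) = a (\<epsilon> - {0})" for \<epsilon> by simp
    have "f {} = 0" using a lin_empty empty_in_cube by metis
    then show "dist u x < \<delta>" "dist v y < \<delta>"
      using near[OF empty_in_cube] \<open>\<delta> > 0\<close> by (auto simp: z0)
    show "dist (zact X S (?a \<epsilon>) u) (zact X S (?a \<epsilon>) v) < \<delta>" if "\<epsilon> \<in> cube d - {{}}" for \<epsilon>
      using near[of \<epsilon>] that fa[of \<epsilon>] dist_triangle_half_l[of "zact X S (f \<epsilon>) u" "b \<epsilon>" \<delta> "zact X S (f \<epsilon>) v"]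
      by auto
  qed
qed

text \<open>A single exponent on \<open>d + 1\<close> directions serves both blocks: the second base
  point is \<open>T (a {0}) x\<close>, and exponents add over the disjoint union with
  \<open>{0}\<close>. The common tuple becomes constantly \<open>y\<close>.\<close>

lemma RP_intro:
  assumes "x \<in> X" "y \<in> X"
    and approx: "\<And>\<delta>. \<delta> > 0 \<Longrightarrow> \<exists>a\<in>lin. \<forall>\<epsilon>. \<epsilon> \<subseteq> {0..d} \<and> \<epsilon> \<noteq> {} \<longrightarrow> dist (T (a \<epsilon>) x) y < \<delta>"
  shows "(x, y) \<in> RP X S d"
proof -
  have "\<exists>a. a \<in> lin \<and> (\<forall>\<epsilon>. \<epsilon> \<subseteq> {0..d} \<and> \<epsilon> \<noteq> {} \<longrightarrow> dist (T (a \<epsilon>) x) y < inverse (real (Suc k)))" for k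
    using approx[of "inverse (real (Suc k))"] by auto
  then obtain a where a: "\<And>k. a k \<in> lin"
    "\<And>k \<epsilon>. \<lbrakk>\<epsilon> \<subseteq> {0..d}; \<epsilon> \<noteq> {}\<rbrakk> \<Longrightarrow> dist (T (a k \<epsilon>) x) y < inverse (real (Suc k))"
    by metis
  have lim: "(\<lambda>k. T (a k \<epsilon>) x) \<longlonglongrightarrow> y" if "\<epsilon> \<subseteq> {0..d}" "\<epsilon> \<noteq> {}" for \<epsilon>
  proof (rule metric_tendsto_imp_tendsto[OF LIMSEQ_inverse_real_of_nat])
    show "\<forall>\<^sub>F k in sequentially. dist (T (a k \<epsilon>) x) y \<le> dist (inverse (real (Suc k))) 0"
      using a(2)[OF that] by (intro always_eventually allI) (simp add: less_imp_le)
  qed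
  let ?t = "\<lambda>k. (restrict (a k) (cube d), x, T (a k {0}) x)"
  let ?b = "\<lambda>\<epsilon>\<in>cube d - {{}}. y"
  have sub: "\<epsilon> \<subseteq> {0..d}" if "\<epsilon> \<in> cube d" for \<epsilon> using that by (force simp: cube_def)
  have "(\<lambda>k. zact X S (restrict (a k) (cube d) \<epsilon>) x) \<longlonglongrightarrow> (?b({} := x)) \<epsilon>" if "\<epsilon> \<in> cube d" for \<epsilon>
  proof (cases "\<epsilon> = {}")
    case True
    then show ?thesis using that lin_empty[OF a(1)] zact_int[of 0] by simp
  next
    case False
    then show ?thesis using lim[OF sub[OF that] False] that assms(1) by (simp add: T_def)
  qed
  moreover have "(\<lambda>k. zact X S (restrict (a k) (cube d) \<epsilon>) (T (a k {0}) x)) \<longlonglongrightarrow> (?b({} := y)) \<epsilon>"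
    if \<epsilon>: "\<epsilon> \<in> cube d" for \<epsilon>
  proof -
    have "\<epsilon> \<inter> {0} = {}" using \<epsilon> by (auto simp: cube_def)
    then have "zact X S (restrict (a k) (cube d) \<epsilon>) (T (a k {0}) x) = T (a k (\<epsilon> \<union> {0})) x" for k
      using lin_Un[OF a(1), of \<epsilon> "{0}" k] \<epsilon> assms(1) by (simp add: T_def zact_in zact_add)
    moreover have "(\<lambda>k. T (a k (\<epsilon> \<union> {0})) x) \<longlonglongrightarrow> y" using lim[of "\<epsilon> \<union> {0}"] sub[OF \<epsilon>] by simp
    ultimately show ?thesis using \<epsilon> by simp
  qed
  moreover have "?b \<in> cube d - {{}} \<rightarrow>\<^sub>E X" using assms(2) by auto
  moreover have "restrict (a k) (cube d) \<in> face_group integer_group d \<and> x \<in> X \<and> T (a k {0}) x \<in> X" for k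
    using a(1) lin_imp_face_group assms(1) T_in by simp
  ultimately show ?thesis
    unfolding RP_iff using assms(1,2)
    by (intro conjI exI[of _ "filtermap ?t sequentially"] bexI[of _ ?b])
      (simp_all add: filtermap_bot_iff eventually_filtermap filterlim_filtermap)
qed

end

lemma minimal_tds_cascade: "minimal_tds X S \<Longrightarrow> cascade X S"
  by (simp add: minimal_tds_def cascade_def)

context cascade
begin

section \<open>Consequences of minimality\<close>

lemma orbit_sequence:
  assumes "minimal_tds X S" "y \<in> X" "v \<in> X"
  obtains s where "(\<lambda>k. T (s k) y) \<longlonglongrightarrow> v"
proof -
  have "v \<in> closure (zorbit X S y)" using assms by (simp add: minimal_tds_def)
  then obtain z where z: "\<And>k. z k \<in> zorbit X S y" "z \<longlonglongrightarrow> v"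
    unfolding closure_sequential by blast
  then have "\<exists>n. z k = T n y" for k using z(1)[of k] assms(2) by (auto simp: zorbit_def T_def)
  then obtain s where "\<And>k. z k = T (s k) y" by metis
  then have "z = (\<lambda>k. T (s k) y)" by (rule ext)
  then show ?thesis using that z(2) by simp
qed

lemma orbit_approx:
  assumes "minimal_tds X S" "y \<in> X" "v \<in> X" "finite N" "\<delta> > 0"
  obtains s where "\<And>n. n \<in> N \<Longrightarrow> dist (T n (T s y)) (T n v) < \<delta>"
proof -
  obtain s where s: "(\<lambda>k. T (s k) y) \<longlonglongrightarrow> v" using orbit_sequence assms(1-3) by blast
  have "(\<lambda>k. T n (T (s k) y)) \<longlonglongrightarrow> T n v" for n
    using assms(2) T_in
    by (intro continuous_on_tendsto_compose[OF continuous_on_T s \<open>v \<in> X\<close>] always_eventually) auto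
  then have "\<forall>\<^sub>F k in sequentially. \<forall>n\<in>N. dist (T n (T (s k) y)) (T n v) < \<delta>"
    using assms(4,5) by (intro eventually_ball_finite ballI tendstoD) auto
  then obtain k where "\<forall>n\<in>N. dist (T n (T (s k) y)) (T n v) < \<delta>"
    using eventually_happens' sequentially_bot by blast
  then show ?thesis using that[of "s k"] by blast
qed

lemma continuous_on_Et_eval: "continuous_on A (\<lambda>q::'a \<Rightarrow> 'a. q x)"
  by (rule continuous_on_product_then_coordinatewise[OF continuous_on_id])

lemma Et_transitive:
  assumes "minimal_tds X S" "y \<in> X" "v \<in> X"
  shows "\<exists>q\<in>Et. q y = v"
proof -
  obtain s where s: "(\<lambda>k. T (s k) y) \<longlonglongrightarrow> v" using orbit_sequence assms by blast
  have "closed ((\<lambda>q. q y) ` Et)"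
    using compact_continuous_image[OF continuous_on_Et_eval compact_Et] compact_imp_closed by blast
  moreover have "T (s k) y \<in> (\<lambda>q. q y) ` Et" for k using T_Et by blast
  ultimately have "v \<in> (\<lambda>q. q y) ` Et" by (rule closed_sequentially[OF _ _ s])
  then show ?thesis by blast
qed

text \<open>The maps fixing \<open>y\<close> form a closed subsemigroup. Since \<open>Et\<close> is
  transitive on \<open>X\<close>, every element of \<open>Et\<close> can be multiplied from the left
  into it, so a minimal idempotent can be found there.\<close>

lemma ellis_exists:
  assumes "minimal_tds X S" "y \<in> X"
  obtains u where "ellis X S u" "u y = y"
proof -
  let ?D = "{p::'a \<Rightarrow> 'a. p y = y}"
  obtain u where u: "u \<in> Et" "u \<in> ?D" "u \<circ> u = u"
    "\<And>p. \<lbrakk>p \<in> Et; (p \<circ> u) \<circ> (p \<circ> u) = p \<circ> u\<rbrakk> \<Longrightarrow> u \<circ> (p \<circ> u) = u"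
  proof (rule minimal_idempotent_exists[where f = "(\<circ>)" and E = Et and D = ?D])
    show "continuous_on Et (\<lambda>p. p \<circ> q)" for q
      unfolding o_def by (rule continuous_on_coordinatewise_then_product) (rule continuous_on_Et_eval)
    have "closed ((\<lambda>p::'a \<Rightarrow> 'a. p y) -` {y})"
      by (rule closed_vimage[OF closed_singleton continuous_on_Et_eval])
    then show "closed ?D" by (simp add: vimage_def)
    show "\<exists>q\<in>Et. q \<circ> p \<in> ?D" if "p \<in> Et" for p
      using Et_transitive[OF assms(1) Et_in[OF that assms(2)] assms(2)] by auto
  qed (simp_all add: compact_Et Et_nonempty Et_comp comp_assoc)
  then have "ellis X S u" by unfold_locales auto
  then show ?thesis using that u(2) by blast
qed

end

section \<open>Extensions\<close>

locale cascade_extension = X: cascade X S + Y: cascade Y R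
  for X :: "'a::metric_space set" and S :: "'a \<Rightarrow> 'a"
    and Y :: "'b::metric_space set" and R :: "'b \<Rightarrow> 'b" +
  fixes \<pi> :: "'a \<Rightarrow> 'b"
  assumes ext: "tds_extension X S Y R \<pi>"
begin

lemma continuous_on_pi: "continuous_on X \<pi>" and pi_image: "\<pi> ` X = Y"
  and pi_S: "x \<in> X \<Longrightarrow> \<pi> (S x) = R (\<pi> x)"
  using ext by (simp_all add: tds_extension_def)

lemma pi_in: "x \<in> X \<Longrightarrow> \<pi> x \<in> Y"
  using pi_image by blast

lemma pi_zact:
  assumes "x \<in> X"
  shows "\<pi> (zact X S n x) = zact Y R n (\<pi> x)"
proof (induction n rule: int_induct[of _ 0])
  case base
  show ?case using X.zact_int[of 0] Y.zact_int[of 0] by simp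
next
  case (step1 n)
  then show ?case
    using X.zact_Suc[OF assms, of n] Y.zact_Suc[OF pi_in[OF assms], of n] pi_S[OF X.zact_in[OF assms]]
    by simp
next
  case (step2 n)
  have "R (\<pi> (zact X S (n - 1) x)) = R (zact Y R (n - 1) (\<pi> x))"
    using X.zact_Suc[OF assms, of "n - 1"] Y.zact_Suc[OF pi_in[OF assms], of "n - 1"]
      pi_S[OF X.zact_in[OF assms]] step2(2) by simp
  then have "inv_into Y R (R (\<pi> (zact X S (n - 1) x))) = inv_into Y R (R (zact Y R (n - 1) (\<pi> x)))"
    by simp
  then show ?case by (simp add: Y.inv_S pi_in X.zact_in Y.zact_in assms)
qed

lemma pi_T: "x \<in> X \<Longrightarrow> \<pi> (X.T n x) = Y.T n (\<pi> x)"
  by (simp add: X.T_def Y.T_def pi_in pi_zact)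

lemma continuous_on_pi_eval: "x \<in> X \<Longrightarrow> continuous_on X.EG (\<lambda>p. \<pi> (p \<epsilon> x))"
  by (rule continuous_on_compose2[OF continuous_on_pi continuous_on_coordinates])
    (use X.EG_Et X.Et_in in blast)

text \<open>Holds for powers of \<open>S\<close> and passes to limits, since both sides are
  continuous in the map for fixed points. It makes \<open>Et\<close> act on \<open>Y\<close> through
  \<open>\<pi>\<close>, so no enveloping semigroup of \<open>Y\<close> is introduced.\<close>

lemma pi_Et_cong:
  assumes "q \<in> X.Et" "x \<in> X" "x' \<in> X" "\<pi> x = \<pi> x'"
  shows "\<pi> (q x) = \<pi> (q x')"
proof -
  let ?d = "\<lambda>p::nat set \<Rightarrow> 'a \<Rightarrow> 'a. dist (\<pi> (p {} x)) (\<pi> (p {} x'))"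
  have "?d ` X.G \<subseteq> {0}" using assms(2-4) by (auto simp: X.G_def pi_T)
  moreover have "continuous_on (closure X.G) ?d"
    using continuous_on_dist[OF continuous_on_pi_eval continuous_on_pi_eval] assms
    by (simp add: X.EG_def)
  ultimately have "?d ` X.EG \<subseteq> {0}"
    unfolding X.EG_def by (intro image_closure_subset) auto
  then show ?thesis using assms(1) unfolding X.Et_def by auto
qed

lemma RP_image:
  assumes "(x, y) \<in> RP X S d"
  shows "(\<pi> x, \<pi> y) \<in> RP Y R d"
proof -
  obtain \<F> a where xy: "x \<in> X" "y \<in> X" and a: "a \<in> (cube d - {{}}) \<rightarrow>\<^sub>E X" and \<F>: "\<F> \<noteq> bot"
    and ev: "\<forall>\<^sub>F t in \<F>. fst t \<in> face_group integer_group d \<and> fst (snd t) \<in> X \<and> snd (snd t) \<in> X"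
    and lim: "\<forall>\<epsilon>\<in>cube d. ((\<lambda>t. zact X S (fst t \<epsilon>) (fst (snd t))) \<longlongrightarrow> (a({} := x)) \<epsilon>) \<F>"
      "\<forall>\<epsilon>\<in>cube d. ((\<lambda>t. zact X S (fst t \<epsilon>) (snd (snd t))) \<longlongrightarrow> (a({} := y)) \<epsilon>) \<F>"
    using assms unfolding X.RP_iff by blast
  let ?b = "\<lambda>\<epsilon>\<in>cube d - {{}}. \<pi> (a \<epsilon>)"
  have lim_pi: "((\<lambda>t. zact Y R (fst t \<epsilon>) (\<pi> (w t))) \<longlongrightarrow> (?b({} := \<pi> z)) \<epsilon>) \<F>"
    if \<epsilon>: "\<epsilon> \<in> cube d" and w: "\<forall>\<^sub>F t in \<F>. w t \<in> X" and z: "z \<in> X"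
      and l: "((\<lambda>t. zact X S (fst t \<epsilon>) (w t)) \<longlongrightarrow> (a({} := z)) \<epsilon>) \<F>" for \<epsilon> w z
  proof -
    have "(a({} := z)) \<epsilon> \<in> X" using a \<epsilon> z by auto
    moreover have "\<forall>\<^sub>F t in \<F>. zact X S (fst t \<epsilon>) (w t) \<in> X"
      using w by (rule eventually_mono) (rule X.zact_in)
    ultimately have "((\<lambda>t. \<pi> (zact X S (fst t \<epsilon>) (w t))) \<longlongrightarrow> \<pi> ((a({} := z)) \<epsilon>)) \<F>"
      by (rule continuous_on_tendsto_compose[OF continuous_on_pi l])
    moreover have "\<forall>\<^sub>F t in \<F>. \<pi> (zact X S (fst t \<epsilon>) (w t)) = zact Y R (fst t \<epsilon>) (\<pi> (w t))"
      using w by (rule eventually_mono) (rule pi_zact)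
    ultimately have "((\<lambda>t. zact Y R (fst t \<epsilon>) (\<pi> (w t))) \<longlongrightarrow> \<pi> ((a({} := z)) \<epsilon>)) \<F>"
      by (rule Lim_transform_eventually)
    moreover have "\<pi> ((a({} := z)) \<epsilon>) = (?b({} := \<pi> z)) \<epsilon>" using \<epsilon> by simp
    ultimately show ?thesis by simp
  qed
  have ev': "\<forall>\<^sub>F t in \<F>. fst (snd t) \<in> X" "\<forall>\<^sub>F t in \<F>. snd (snd t) \<in> X"
    using ev by (auto elim: eventually_mono)
  have "?b \<in> cube d - {{}} \<rightarrow>\<^sub>E Y" using a pi_in by (auto simp: PiE_iff)
  moreover have "\<forall>\<^sub>F t in \<F>. fst t \<in> face_group integer_group d \<and> \<pi> (fst (snd t)) \<in> Y \<and> \<pi> (snd (snd t)) \<in> Y"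
    using ev by (rule eventually_mono) (simp add: pi_in)
  moreover have "\<forall>\<epsilon>\<in>cube d. ((\<lambda>t. zact Y R (fst t \<epsilon>) (\<pi> (fst (snd t)))) \<longlongrightarrow> (?b({} := \<pi> x)) \<epsilon>) \<F>"
    using lim(1) lim_pi[OF _ ev'(1) xy(1)] by blast
  moreover have "\<forall>\<epsilon>\<in>cube d. ((\<lambda>t. zact Y R (fst t \<epsilon>) (\<pi> (snd (snd t)))) \<longlongrightarrow> (?b({} := \<pi> y)) \<epsilon>) \<F>"
    using lim(2) lim_pi[OF _ ev'(2) xy(2)] by blast
  ultimately show ?thesis
    unfolding Y.RP_iff using pi_in xy \<F>
    by (intro conjI exI[of _ "filtermap (\<lambda>t. (fst t, \<pi> (fst (snd t)), \<pi> (snd (snd t)))) \<F>"] bexI[of _ ?b])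
      (simp_all add: filtermap_bot_iff eventually_filtermap filterlim_filtermap)
qed

text \<open>The last direction of a \<open>d + 1\<close>-dimensional cube, which separates the two points of a pair
  in \<open>RP\<close>, is indexed by 0.\<close>

lemma RP_enveloping:
  assumes "minimal_tds Y R" "(y1, y2) \<in> RP Y R d" "x2 \<in> X" "\<pi> x2 = y2"
  obtains p where "p \<in> X.EG" "\<pi> (p {} x2) = y1" "\<pi> (p {0} x2) = y2"
    "\<And>\<epsilon>. \<epsilon> \<in> cube d - {{}} \<Longrightarrow> \<pi> (p \<epsilon> x2) = \<pi> (p (insert 0 \<epsilon>) x2)"
proof -
  let ?C = "cube d - {{}}"
  \<comment> \<open>The total failure of the required equations. It is continuous on the compact
    \<open>X.EG\<close> and attains its minimum, so arbitrarily small values suffice and no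
    convergent subnet has to be chosen.\<close>
  define \<Phi> where "\<Phi> p = dist (\<pi> (p {} x2)) y1 + dist (\<pi> (p {0} x2)) y2 +
    (\<Sum>\<epsilon>\<in>?C. dist (\<pi> (p \<epsilon> x2)) (\<pi> (p (insert 0 \<epsilon>) x2)))" for p :: "nat set \<Rightarrow> 'a \<Rightarrow> 'a"
  have fin: "finite ?C" using finite_cube by simp
  have "continuous_on X.EG \<Phi>"
    unfolding \<Phi>_def
    by (intro continuous_on_add continuous_on_sum continuous_on_dist continuous_on_const
        continuous_on_pi_eval \<open>x2 \<in> X\<close>)
  moreover have "X.EG \<noteq> {}" using X.Et_nonempty by (simp add: X.Et_def)
  ultimately obtain p where p: "p \<in> X.EG" "\<And>q. q \<in> X.EG \<Longrightarrow> \<Phi> p \<le> \<Phi> q"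
    using continuous_attains_inf[OF X.compact_EG] by blast
  \<comment> \<open>The two distinguished vertices cost \<open>2 * \<delta>\<close> each, and every
    vertex in \<open>?C\<close> costs \<open>3 * \<delta>\<close>.\<close>
  have "\<exists>q\<in>X.EG. \<Phi> q \<le> (4 + 3 * real (card ?C)) * \<delta>" if "\<delta> > 0" for \<delta> :: real
  proof -
    obtain a u v where a: "a \<in> lin" "\<And>\<epsilon>. a (\<epsilon> - {0}) = a \<epsilon>" and uv: "u \<in> Y" "v \<in> Y"
      and near: "dist u y1 < \<delta>" "dist v y2 < \<delta>"
        "\<And>\<epsilon>. \<epsilon> \<in> ?C \<Longrightarrow> dist (zact Y R (a \<epsilon>) u) (zact Y R (a \<epsilon>) v) < \<delta>"
      using Y.RP_approx[OF assms(2) \<open>\<delta> > 0\<close>] by metis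
    have y2: "y2 \<in> Y" using assms(3,4) pi_in by blast
    have finN: "finite (a ` cube d)" using finite_cube by simp
    obtain s where s: "\<And>n. n \<in> a ` cube d \<Longrightarrow> dist (Y.T n (Y.T s y2)) (Y.T n u) < \<delta>"
      using Y.orbit_approx[OF assms(1) y2 uv(1) finN \<open>\<delta> > 0\<close>] by blast
    obtain t where t: "\<And>n. n \<in> a ` cube d \<Longrightarrow> dist (Y.T n (Y.T t y2)) (Y.T n v) < \<delta>"
      using Y.orbit_approx[OF assms(1) y2 uv(2) finN \<open>\<delta> > 0\<close>] by blast
    \<comment> \<open>The shift \<open>s\<close> brings \<open>y2\<close> close to \<open>u\<close>
      and the shift \<open>t\<close> brings it close to \<open>v\<close>; direction \<open>0\<close>
      switches between them.\<close>
    define q where "q = (\<lambda>\<epsilon>. X.T (s + (a \<epsilon> + (if 0 \<in> \<epsilon> then t - s else 0))))"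
    have "q \<in> X.EG"
      unfolding q_def X.EG_def using X.G_I[OF lin.face[OF a(1)]] closure_subset by blast
    have pi_q: "\<pi> (q \<epsilon> x2) = Y.T (a \<epsilon>) (Y.T (if 0 \<in> \<epsilon> then t else s) y2)" for \<epsilon>
    proof -
      have "s + (a \<epsilon> + (if 0 \<in> \<epsilon> then t - s else 0)) = a \<epsilon> + (if 0 \<in> \<epsilon> then t else s)" by simp
      then have "q \<epsilon> = X.T (a \<epsilon> + (if 0 \<in> \<epsilon> then t else s))" unfolding q_def by (simp only:)
      then show ?thesis using assms(3,4) by (simp add: pi_T Y.T_add)
    qed
    have a0: "a {} = 0" "a {0} = 0" using lin_empty[OF a(1)] a(2)[of "{0}"] by auto
    have "0 \<in> a ` cube d" using a0(1) empty_in_cube[of d] by force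
    then have "dist (Y.T s y2) u < \<delta>" "dist (Y.T t y2) v < \<delta>"
      using s[of 0] t[of 0] by (simp_all add: Y.T_0)
    then have q0: "dist (\<pi> (q {} x2)) y1 \<le> 2 * \<delta>" "dist (\<pi> (q {0} x2)) y2 \<le> 2 * \<delta>"
      using near(1,2) dist_triangle[of "Y.T s y2" y1 u] dist_triangle[of "Y.T t y2" y2 v]
      by (simp_all add: pi_q a0 Y.T_0)
    have "dist (\<pi> (q \<epsilon> x2)) (\<pi> (q (insert 0 \<epsilon>) x2)) \<le> 3 * \<delta>" if \<epsilon>: "\<epsilon> \<in> ?C" for \<epsilon>
    proof -
      have "0 \<notin> \<epsilon>" using \<epsilon> by (auto simp: cube_def)
      then have a\<epsilon>: "a (insert 0 \<epsilon>) = a \<epsilon>" using a(2)[of "insert 0 \<epsilon>"] by simp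
      have "dist (Y.T (a \<epsilon>) u) (Y.T (a \<epsilon>) v) < \<delta>" using near(3)[OF \<epsilon>] uv by (simp add: Y.T_def)
      moreover have "dist (Y.T (a \<epsilon>) (Y.T s y2)) (Y.T (a \<epsilon>) u) < \<delta>"
        "dist (Y.T (a \<epsilon>) (Y.T t y2)) (Y.T (a \<epsilon>) v) < \<delta>"
        using s t \<epsilon> by auto
      moreover have "dist A D \<le> dist A B + dist B C + dist D C" for A B C D :: 'b
        using dist_triangle[of A D B] dist_triangle[of B D C] by (simp add: dist_commute)
      ultimately have "dist (Y.T (a \<epsilon>) (Y.T s y2)) (Y.T (a \<epsilon>) (Y.T t y2)) \<le> 3 * \<delta>"
        by (smt (verit))
      then show ?thesis using \<open>0 \<notin> \<epsilon>\<close> by (simp add: pi_q a\<epsilon>)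
    qed
    then have "(\<Sum>\<epsilon>\<in>?C. dist (\<pi> (q \<epsilon> x2)) (\<pi> (q (insert 0 \<epsilon>) x2))) \<le> card ?C * (3 * \<delta>)"
      using sum_bounded_above[of ?C _ "3 * \<delta>"] by simp
    then have "\<Phi> q \<le> (4 + 3 * real (card ?C)) * \<delta>"
      using q0 by (simp add: \<Phi>_def algebra_simps)
    then show ?thesis using \<open>q \<in> X.EG\<close> by blast
  qed
  then have bound: "\<Phi> p \<le> (4 + 3 * real (card ?C)) * \<delta>" if "\<delta> > 0" for \<delta> :: real
    using p(2) that order_trans by meson
  have "\<Phi> p \<le> 0"
  proof (rule field_le_epsilon)
    fix e :: real assume "e > 0"
    have "4 + 3 * real (card ?C) > 0" by (simp add: add_pos_nonneg)
    then show "\<Phi> p \<le> 0 + e"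
      using bound[of "e / (4 + 3 * real (card ?C))"] \<open>e > 0\<close> by simp
  qed
  moreover have nonneg: "(\<Sum>\<epsilon>\<in>?C. dist (\<pi> (p \<epsilon> x2)) (\<pi> (p (insert 0 \<epsilon>) x2))) \<ge> 0"
    by (intro sum_nonneg) simp
  ultimately have "dist (\<pi> (p {} x2)) y1 = 0" "dist (\<pi> (p {0} x2)) y2 = 0"
    "(\<Sum>\<epsilon>\<in>?C. dist (\<pi> (p \<epsilon> x2)) (\<pi> (p (insert 0 \<epsilon>) x2))) = 0"
    using zero_le_dist[of "\<pi> (p {} x2)" y1] zero_le_dist[of "\<pi> (p {0} x2)" y2]
    unfolding \<Phi>_def by linarith+
  then have "\<pi> (p {} x2) = y1" "\<pi> (p {0} x2) = y2"
    "\<And>\<epsilon>. \<epsilon> \<in> ?C \<Longrightarrow> \<pi> (p \<epsilon> x2) = \<pi> (p (insert 0 \<epsilon>) x2)"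
    using fin by (simp_all add: sum_nonneg_eq_0_iff)
  then show ?thesis using that p(1) by blast
qed

end


lemma (in ellis) EF_approx:
  assumes "q \<in> EF" "finite C" "\<delta> > 0"
  shows "\<exists>a\<in>lin. \<forall>\<epsilon>\<in>C. dist (T (a \<epsilon>) x) (q \<epsilon> x) < \<delta>"
proof -
  let ?V = "\<Inter>\<epsilon>\<in>C. {p::nat set \<Rightarrow> 'a \<Rightarrow> 'a. dist (p \<epsilon> x) (q \<epsilon> x) < \<delta>}"
  have "open ?V"
    using \<open>finite C\<close>
    by (intro open_INT ballI open_Collect_less continuous_on_dist continuous_on_coordinates continuous_on_const)
  moreover have "q \<in> ?V" using \<open>\<delta> > 0\<close> by simp
  ultimately have "?V \<inter> F \<noteq> {}"
    using assms(1) open_Int_closure_eq_empty[of ?V F] unfolding EF_def by blast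
  then obtain a where "a \<in> lin" "(\<lambda>\<epsilon>. T (a \<epsilon>)) \<in> ?V" unfolding F_def by blast
  then show ?thesis by auto
qed

section \<open>Lifting a regionally proximal pair\<close>

locale ellis_extension = cascade_extension X S Y R \<pi> + X: ellis X S u
  for X :: "'a::metric_space set" and S :: "'a \<Rightarrow> 'a"
    and Y :: "'b::metric_space set" and R :: "'b \<Rightarrow> 'b" and \<pi> and u +
  fixes x2 :: 'a
  assumes x2: "x2 \<in> X" "u x2 = x2"
begin

lemma pi_Ug_cong: "\<lbrakk>q \<in> X.Ug; x \<in> X; x' \<in> X; \<pi> x = \<pi> x'\<rbrakk> \<Longrightarrow> \<pi> (q x) = \<pi> (q x')"
  using pi_Et_cong[OF X.Ug_Et] .

lemma Ug_in: "q \<in> X.Ug \<Longrightarrow> x \<in> X \<Longrightarrow> q x \<in> X"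
  using X.Et_in[OF X.Ug_Et] .

lemma stabilizer_inv:
  assumes "q \<in> X.Ug" "\<pi> (q x2) = \<pi> x2"
  shows "\<pi> (X.ginv q x2) = \<pi> x2"
proof -
  have "\<pi> (X.ginv q x2) = \<pi> (X.ginv q (q x2))"
    using pi_Ug_cong[OF X.ginv_Ug[OF assms(1)] x2(1) Ug_in[OF assms(1) x2(1)]] assms(2) by simp
  also have "X.ginv q (q x2) = x2" using fun_cong[OF X.ginv_left[OF assms(1)], of x2] x2(2) by simp
  finally show ?thesis .
qed

text \<open>Each round divides by one upper facet, whose entries stabilize \<open>\<pi> x2\<close>,
  so no image in \<open>Y\<close> changes. The induction runs over \<open>i\<close> with
  \<open>n\<close> fixed, which keeps the stabilizer hypothesis for the facets still to be
  cleared.\<close>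

lemma stabilizer_clear_facets:
  assumes "k \<in> X.HK" "\<And>\<epsilon>. \<epsilon> \<inter> {..<n} \<noteq> {} \<Longrightarrow> \<pi> (k \<epsilon> x2) = \<pi> x2" "i \<le> n"
  shows "\<exists>k'\<in>X.HK. (\<forall>\<epsilon>. \<pi> (k' \<epsilon> x2) = \<pi> (k \<epsilon> x2)) \<and> (\<forall>\<epsilon>. \<epsilon> \<inter> {..<i} \<noteq> {} \<longrightarrow> k' \<epsilon> = u)"
  using assms(3)
proof (induction i)
  case 0
  show ?case using assms(1) by (intro bexI[of _ k]) simp_all
next
  case (Suc i)
  then obtain k' where k': "k' \<in> X.HK" "\<And>\<epsilon>. \<pi> (k' \<epsilon> x2) = \<pi> (k \<epsilon> x2)"
    "\<And>\<epsilon>. \<epsilon> \<inter> {..<i} \<noteq> {} \<Longrightarrow> k' \<epsilon> = u"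
    by auto
  \<comment> \<open>The upper facet in direction \<open>i\<close>, copied to both facets and
    inverted. As \<open>i < n\<close>, even its entry at \<open>{}\<close> comes from a vertex where
    the stabilizer hypothesis holds.\<close>
  define r where "r \<epsilon> = X.ginv (k' (insert i \<epsilon>))" for \<epsilon>
  have r: "r \<in> X.HK"
    using X.HK_inv[OF X.HK_reindex[OF affine_reindex_insert k'(1)]] by (simp add: r_def[abs_def])
  let ?k = "\<lambda>\<epsilon>. k' \<epsilon> \<circ> r \<epsilon>"
  have "?k \<in> X.HK" using X.HK_comp[OF k'(1) r] .
  moreover have "\<pi> (?k \<epsilon> x2) = \<pi> (k \<epsilon> x2)" for \<epsilon>
  proof -
    have "insert i \<epsilon> \<inter> {..<n} \<noteq> {}" using Suc.prems by auto
    then have "\<pi> (r \<epsilon> x2) = \<pi> x2"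
      unfolding r_def using k'(2) assms(2) by (intro stabilizer_inv X.HK_Ug k'(1)) simp
    then have "\<pi> (k' \<epsilon> (r \<epsilon> x2)) = \<pi> (k' \<epsilon> x2)"
      using pi_Ug_cong[OF X.HK_Ug[OF k'(1)] Ug_in[OF X.HK_Ug[OF r] x2(1)] x2(1)] by simp
    then show ?thesis using k'(2) by simp
  qed
  moreover have "?k \<epsilon> = u" if \<epsilon>: "\<epsilon> \<inter> {..<Suc i} \<noteq> {}" for \<epsilon>
  proof (cases "i \<in> \<epsilon>")
    case True
    then show ?thesis using X.ginv_right[OF X.HK_Ug[OF k'(1)]] by (simp add: r_def insert_absorb)
  next
    case False
    then have *: "\<epsilon> \<inter> {..<i} \<noteq> {}" using \<epsilon> by (auto simp: less_Suc_eq)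
    \<comment> \<open>So the divisor is \<open>u\<close> here as well, and facets cleared earlier
      stay cleared.\<close>
    then have "insert i \<epsilon> \<inter> {..<i} \<noteq> {}" by blast
    then have "k' \<epsilon> = u" "k' (insert i \<epsilon>) = u" using k'(3)[OF *] k'(3) by simp_all
    then show ?thesis by (simp add: r_def X.ginv_u X.u_idem)
  qed
  ultimately show ?case by (intro bexI[of _ ?k]) auto
qed

lemma RP_lift:
  assumes "minimal_tds Y R" "(y1, \<pi> x2) \<in> RP Y R d"
  shows "\<exists>x1 x'. \<pi> x1 = y1 \<and> \<pi> x' = \<pi> x2 \<and> (x1, x') \<in> RP X S d"
proof -
  let ?D = "{..<Suc d}"
  have "y1 \<in> Y" using assms(2) by (simp add: Y.RP_iff)
  then obtain x1 where x1: "x1 \<in> X" "\<pi> x1 = y1" using pi_image by blast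
  obtain p where p: "p \<in> X.EG" "\<pi> (p {} x2) = y1" "\<pi> (p {0} x2) = \<pi> x2"
    "\<And>\<epsilon>. \<epsilon> \<in> cube d - {{}} \<Longrightarrow> \<pi> (p \<epsilon> x2) = \<pi> (p (insert 0 \<epsilon>) x2)"
    using RP_enveloping[OF assms x2(1) refl] by blast
  have p_in: "p \<epsilon> x2 \<in> X" for \<epsilon> using X.Et_in[OF X.EG_Et[OF p(1)] x2(1)] .
  \<comment> \<open>The projection by \<open>u\<close> puts the entries into \<open>Ug\<close>, at
    the cost of replacing \<open>y1\<close> by the image of \<open>u x1\<close>; the intersection
    removes dependence on directions beyond \<open>0, ..., d\<close>.\<close>
  define g0 where "g0 \<epsilon> = u \<circ> p (\<epsilon> \<inter> ?D) \<circ> u" for \<epsilon>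
  have g0: "g0 \<in> X.HK"
    using X.HK_proj[OF X.EG_reindex[OF affine_reindex_Int p(1)]] by (simp add: g0_def[abs_def])
  have u_cong: "\<lbrakk>x \<in> X; x' \<in> X; \<pi> x = \<pi> x'\<rbrakk> \<Longrightarrow> \<pi> (u x) = \<pi> (u x')" for x x'
    using pi_Ug_cong[OF X.u_Ug] .
  have g0_x2: "g0 \<epsilon> x2 = u (p (\<epsilon> \<inter> ?D) x2)" for \<epsilon> by (simp add: g0_def x2(2))
  have g0_empty: "\<pi> (g0 {} x2) = \<pi> (u x1)"
    using u_cong[OF p_in x1(1)] p(2) x1(2) by (simp add: g0_x2)
  have "{0} \<inter> ?D = {0}" by auto
  then have g0_0: "\<pi> (g0 {0} x2) = \<pi> x2"
    using u_cong[OF p_in x2(1) p(3)] x2(2) by (simp add: g0_x2)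
  have g0_insert: "\<pi> (g0 \<epsilon> x2) = \<pi> (g0 (insert 0 \<epsilon>) x2)" if "\<epsilon> \<inter> ?D \<noteq> {}" for \<epsilon>
  proof (cases "0 \<in> \<epsilon>")
    case False
    then have "i \<in> {1..d}" if "i \<in> \<epsilon> \<inter> ?D" for i using that by (cases i) auto
    then have "\<epsilon> \<inter> ?D \<in> cube d - {{}}" using that unfolding cube_def by blast
    moreover have "insert 0 \<epsilon> \<inter> ?D = insert 0 (\<epsilon> \<inter> ?D)" by auto
    ultimately show ?thesis
      using u_cong[OF p_in p_in p(4)[of "\<epsilon> \<inter> ?D"]] by (simp only: g0_x2)
  qed (simp add: insert_absorb)
  \<comment> \<open>Right multiplication by \<open>r\<close> turns the entry at \<open>{0}\<close>
    into \<open>u\<close>, and no image in \<open>Y\<close> changes because \<open>r\<close>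
    stabilizes \<open>\<pi> x2\<close>.\<close>
  define r where "r = X.ginv (g0 {0})"
  have r: "r \<in> X.Ug" "\<pi> (r x2) = \<pi> x2"
    unfolding r_def using X.ginv_Ug[OF X.HK_Ug[OF g0]] stabilizer_inv[OF X.HK_Ug[OF g0] g0_0] by auto
  define g1 where "g1 \<epsilon> = g0 \<epsilon> \<circ> r" for \<epsilon>
  have g1: "g1 \<in> X.HK" using X.HK_comp[OF g0 X.HK_const[OF r(1)]] by (simp add: g1_def[abs_def])
  have g1_x2: "\<pi> (g1 \<epsilon> x2) = \<pi> (g0 \<epsilon> x2)" for \<epsilon>
    using pi_Ug_cong[OF X.HK_Ug[OF g0] Ug_in[OF r(1) x2(1)] x2(1) r(2)] by (simp add: g1_def)
  have g1_0: "g1 {0} = u" using X.ginv_right[OF X.HK_Ug[OF g0]] by (simp add: g1_def r_def)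
  \<comment> \<open>Each entry is divided by its neighbour in direction \<open>0\<close>: equality
    of images in \<open>Y\<close> becomes membership in the stabilizer, while the entry at
    \<open>{}\<close> survives because \<open>g1 {0} = u\<close>.\<close>
  define k0 where "k0 \<epsilon> = X.ginv (g1 (insert 0 \<epsilon>)) \<circ> g1 \<epsilon>" for \<epsilon>
  have k0: "k0 \<in> X.HK"
    using X.HK_comp[OF X.HK_inv[OF X.HK_reindex[OF affine_reindex_insert g1]] g1]
    by (simp add: k0_def[abs_def])
  have k0_empty: "\<pi> (k0 {} x2) = \<pi> (u x1)"
    using X.Ug_left[OF X.HK_Ug[OF g1]] by (simp add: k0_def g1_0 X.ginv_u g1_x2 g0_empty)
  have "\<pi> (k0 \<epsilon> x2) = \<pi> x2" if "\<epsilon> \<inter> ?D \<noteq> {}" for \<epsilon>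
  proof -
    let ?s = "X.ginv (g1 (insert 0 \<epsilon>))"
    have "\<pi> (g1 \<epsilon> x2) = \<pi> (g1 (insert 0 \<epsilon>) x2)"
      using g0_insert[OF that] by (simp only: g1_x2)
    then have "\<pi> (?s (g1 \<epsilon> x2)) = \<pi> (?s (g1 (insert 0 \<epsilon>) x2))"
      using pi_Ug_cong[OF X.ginv_Ug[OF X.HK_Ug[OF g1]]] Ug_in[OF X.HK_Ug[OF g1] x2(1)] by blast
    also have "?s (g1 (insert 0 \<epsilon>) x2) = x2"
      using fun_cong[OF X.ginv_left[OF X.HK_Ug[OF g1]], of "insert 0 \<epsilon>" x2] x2(2) by simp
    finally show ?thesis by (simp add: k0_def)
  qed
  then obtain k where k: "k \<in> X.HK" "\<And>\<epsilon>. \<pi> (k \<epsilon> x2) = \<pi> (k0 \<epsilon> x2)"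
    "\<And>\<epsilon>. \<epsilon> \<inter> ?D \<noteq> {} \<Longrightarrow> k \<epsilon> = u"
    using stabilizer_clear_facets[OF k0, of "Suc d" "Suc d"] by blast
  define \<beta> where "\<beta> = X.ginv (k {})"
  have \<beta>: "\<beta> \<in> X.Ug" "\<beta> \<circ> k {} = u"
    unfolding \<beta>_def using X.ginv_Ug X.ginv_left X.HK_Ug[OF k(1)] by auto
  \<comment> \<open>Multiplication by the constant \<beta> moves the exceptional entry to the
    others: \<open>{}\<close> gets \<open>u\<close>, as \<open>HK_imp_HF\<close> requires, and the
    remaining vertices of the cube get \<beta>.\<close>
  define h where "h \<epsilon> = \<beta> \<circ> k (\<epsilon> \<inter> ?D)" for \<epsilon>
  have "h \<in> X.HK"
    using X.HK_comp[OF X.HK_const[OF \<beta>(1)] X.HK_reindex[OF affine_reindex_Int k(1)]]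
    by (simp add: h_def[abs_def])
  moreover have "h (\<epsilon> \<inter> ?D) = h \<epsilon>" for \<epsilon> by (simp add: h_def Int_assoc)
  moreover have "h {} = u" using \<beta>(2) by (simp add: h_def)
  ultimately have hF: "(\<lambda>\<epsilon>. if \<epsilon> = {} then id else h \<epsilon>) \<in> X.HF" by (rule X.HK_imp_HF)
  have h: "h \<epsilon> = \<beta>" if "\<epsilon> \<subseteq> {0..d}" "\<epsilon> \<noteq> {}" for \<epsilon>
  proof -
    have "\<epsilon> \<inter> ?D = \<epsilon>" using that(1) by (auto simp: less_Suc_eq_le)
    then show ?thesis using k(3)[of \<epsilon>] that(2) X.Ug_right[OF \<beta>(1)] by (simp add: h_def)
  qed
  have "(x1, \<beta> x1) \<in> RP X S d"
  proof (rule X.RP_intro[OF x1(1) Ug_in[OF \<beta>(1) x1(1)]])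
    fix \<delta> :: real assume "\<delta> > 0"
    then obtain a where a: "a \<in> lin"
      "\<And>\<epsilon>. \<epsilon> \<in> Pow {0..d} \<Longrightarrow> dist (X.T (a \<epsilon>) x1) ((if \<epsilon> = {} then id else h \<epsilon>) x1) < \<delta>"
      using X.EF_approx[OF X.HF_EF[OF hF], of "Pow {0..d}" \<delta> x1] by auto
    have "dist (X.T (a \<epsilon>) x1) (\<beta> x1) < \<delta>" if "\<epsilon> \<subseteq> {0..d}" "\<epsilon> \<noteq> {}" for \<epsilon>
      using a(2)[of \<epsilon>] h[OF that] that by simp
    then show "\<exists>a\<in>lin. \<forall>\<epsilon>. \<epsilon> \<subseteq> {0..d} \<and> \<epsilon> \<noteq> {} \<longrightarrow> dist (X.T (a \<epsilon>) x1) (\<beta> x1) < \<delta>"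
      using a(1) by blast
  qed
  moreover have "\<pi> (\<beta> x1) = \<pi> x2"
  proof -
    \<comment> \<open>Only \<open>u x1\<close> is known to lie over the same point as
      \<open>k {} x2\<close>; the difference from \<open>x1\<close> is absorbed by \<beta>.\<close>
    have "\<beta> x1 = \<beta> (u x1)" using fun_cong[OF X.Ug_right[OF \<beta>(1)], of x1] by simp
    also have "\<pi> \<dots> = \<pi> (\<beta> (k {} x2))"
      using pi_Ug_cong[OF \<beta>(1) Ug_in[OF X.u_Ug x1(1)] Ug_in[OF X.HK_Ug[OF k(1)] x2(1)]]
        k0_empty k(2) by simp
    also have "\<beta> (k {} x2) = x2" using fun_cong[OF \<beta>(2), of x2] x2(2) by simp
    finally show ?thesis .
  qed
  ultimately show ?thesis using x1(2) by blast
qed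

end

theorem corollary5p11:
  fixes X :: "'a::metric_space set" and S :: "'a \<Rightarrow> 'a"
    and Y :: "'b::metric_space set" and R :: "'b \<Rightarrow> 'b"
    and \<pi> :: "'a \<Rightarrow> 'b" and d :: nat
  assumes "minimal_tds X S" and "minimal_tds Y R"
    and "tds_extension X S Y R \<pi>"
    and "d \<ge> 1"
  shows "map_prod \<pi> \<pi> ` RP X S d = RP Y R d"
proof
  interpret cascade_extension X S Y R \<pi>
    by (rule cascade_extension.intro[OF minimal_tds_cascade[OF assms(1)] minimal_tds_cascade[OF assms(2)]
          cascade_extension_axioms.intro[OF assms(3)]])
  show "map_prod \<pi> \<pi> ` RP X S d \<subseteq> RP Y R d"
    using RP_image by auto
  show "RP Y R d \<subseteq> map_prod \<pi> \<pi> ` RP X S d"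
  proof
    fix w assume "w \<in> RP Y R d"
    then obtain y1 y2 where w: "w = (y1, y2)" "(y1, y2) \<in> RP Y R d" by (cases w) simp
    then have "y2 \<in> Y" by (simp add: Y.RP_iff)
    then obtain z where z: "z \<in> X" "\<pi> z = y2" using pi_image by blast
    obtain u where u: "ellis X S u" "u z = z" using X.ellis_exists[OF assms(1) z(1)] by blast
    interpret ellis_extension X S Y R \<pi> u z
      by (rule ellis_extension.intro[OF cascade_extension_axioms u(1)])
        (rule ellis_extension_axioms.intro, rule z(1), rule u(2))
    obtain x1 x' where "\<pi> x1 = y1" "\<pi> x' = y2" "(x1, x') \<in> RP X S d"
      using RP_lift[OF assms(2)] w(2) z(2) by blast
    then show "w \<in> map_prod \<pi> \<pi> ` RP X S d"
      using w(1) by (intro image_eqI[of _ _ "(x1, x')"]) auto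
  qed
qed

end
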